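(* Let $(Y_n,\Gamma_n)_{n\in\mathbb{N}_0}$, $Y_n=(X_n,\phi_n)$, be an AIR MCMC chain with parameter $\beta\in(0,\infty)$ in the setting described in the context, and let $d\colon\mathcal{Y}\times\mathcal{Y}\to[0,\infty)$ be a distance-like function with associated contraction coefficient $\tau(\cdot)$. Assume: (1) there are $M\in[1,\infty)$, $\tau\in[0,1)$ and $k_0\in\mathbb{N}$, independent of $\gamma$, such that $\tau(P_\gamma)\le M$ and $\tau(P_\gamma^{k_0})\le\tau$ for all $\gamma\in\mathcal{I}$; (2) there are a measurable function $V\colon\mathcal{Y}\to[1,\infty)$ and constants $\kappa\in(0,1)$, $b\in(0,\infty)$ such that $P_\gamma V(y)\le\kappa V(y)+b$ for all $\gamma\in\mathcal{I}$ and $y\in\mathcal{Y}$; (3) there are constants $p>2$ and $K\in(0,\infty)$ such that $d(y_1,y_2)\le K\bigl(V^{1/p}(y_1)+V^{1/p}(y_2)\bigr)$ for all $y_1,y_2\in\mathcal{Y}$. Let $f\colon\mathcal{X}\to\mathbb{R}$ be a measurable function such that $h=h_f\colon\mathcal{Y}\to\mathbb{R}$, $h(x,\phi)=f(x)$, is Lipschitz with some constant $L\in(0,\infty)$ with respect to $d$, and $|h|\le V^{1/p}$. Then for every $\varepsilon>\max\bigl\{0,\frac{1}{1+\beta}+\frac1p-\frac12\bigr\}$ there exists a measurable function $C\colon\Omega\to\mathbb{R}$ such that for $\mathbb{P}$-almost all $\omega\in\Omega$ and every $n\in\mathbb{N}$, $$\left|\frac1n\sum_{j=1}^n\bigl(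f(X_j(\omega))-\nu(f)\bigr)\right|\le\frac{1}{n^{1/2-\varepsilon}}\,C(\omega).$$
   Context: Setting. $(\mathcal{X},\mathcal{F}_\mathcal{X},\nu)$ is a probability space, $(\Phi,\mathcal{F}_\Phi)$ is a measurable space, and $\mathcal{Y}=\mathcal{X}\times\Phi$ with $\mathcal{F}_\mathcal{Y}=\mathcal{F}_\mathcal{X}\otimes\mathcal{F}_\Phi$; these are Polish spaces with their (countably generated) Borel $\sigma$-algebras, and $d_\mathcal{Y}$ denotes a metric inducing the Polish topology of $\mathcal{Y}$. $(\mathcal{I},\mathcal{F}_\mathcal{I})$ is a measurable space. $\{\pi_\gamma\}_{\gamma\in\mathcal{I}}$ is a family of probability measures on $\mathcal{Y}$ and $\{P_\gamma\}_{\gamma\in\mathcal{I}}$ a family of transition kernels on $\mathcal{Y}$ such that for every $\gamma$: $\pi_\gamma(B\times\Phi)=\nu(B)$ for all $B\in\mathcal{F}_\mathcal{X}$; $\pi_\gamma$ is the invariant distribution of $P_\gamma$; $P_\gamma$ is $\psi$-irreducible and aperiodic. Moreover $(y,\gamma)\mapsto P_\gamma(y,A)$ is measurable for every $A\in\mathcal{F}_\mathcal{Y}$. Write $\nu(f)=\int f\,d\nu$ and $P_\gamma V(y)=\int V(y')\,P_\gamma(y,dy')$. AIR MCMC chain with parameter $\beta>0$. Put $k_j=\lceil j^\beta\rceil$, $T_0=0$, $T_m=\sum_{j=1}^m k_j$. The chain is a process $(Y_n,\Gamma_n)_{n\in\mathbb{N}_0}$ on a probability space $(\Omega,\mathcal{F},\mathbb{P})$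 with values in $\mathcal{Y}\times\mathcal{I}$ such that: $(Y_0,\Gamma_0)=(y_0,\gamma_0)$ is deterministic; with $\mathcal{F}_n=\sigma(Y_0,\dots,Y_n,\Gamma_0,\dots,\Gamma_n)$ one has $\mathbb{P}[Y_{n+1}\in B\mid\mathcal{F}_n]=P_{\Gamma_n}(Y_n,B)$ a.s. for all $B\in\mathcal{F}_\mathcal{Y}$; $\Gamma_n=U_n(Y_0,\dots,Y_n,\Gamma_0,\dots,\Gamma_{n-1})$ for measurable maps $U_n\colon\mathcal{Y}^{n+1}\times\mathcal{I}^n\to\mathcal{I}$; adaptation happens only at the times $T_m$, i.e. $\Gamma_{i_1}=\Gamma_{i_2}$ whenever $i_1,i_2\in\{T_j,\dots,T_{j+1}-1\}$ for some $j$; and $\omega\mapsto\pi_{\Gamma_n(\omega)}(g)$ is measurable for every measurable $g\colon\mathcal{Y}\to\mathbb{R}$ with $\pi_\gamma(|g|)<\infty$ for all $\gamma$. Write $Y_n=(X_n,\phi_n)$ with $X_n\in\mathcal{X}$, $\phi_n\in\Phi$. Distance-like function: $d\colon\mathcal{Y}\times\mathcal{Y}\to[0,\infty)$ that is symmetric, satisfies $d(x,y)=0\iff x=y$, and is lower semi-continuous w.r.t. the product topology induced by $d_\mathcal{Y}$ (no triangle inequality required). Wasserstein-like function: $\mathcal{W}(\mu_1,\mu_2)=\inf_\xi\int d(x,y)\,\xi(dx,dy)$, infimum over all couplings $\xi$ of the probability measures $\mu_1,\mu_2$. Contraction coefficient: $\tau(P_\gamma^\ell)=\sup_{y_1\ne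 y_2}\mathcal{W}(P_\gamma^\ell(y_1,\cdot),P_\gamma^\ell(y_2,\cdot))/d(y_1,y_2)$. A function $\psi$ is Lipschitz with constant $L$ w.r.t. $d$ if $|\psi(x)-\psi(y)|\le L\,d(x,y)$ for all $x,y$. *)

theory Defs
  imports "HOL-Probability.Probability"
begin

section \<open>Transition kernels on a topological space with its Borel sets\<close>

definition transition_kernel :: "('y::topological_space \<Rightarrow> 'y measure) \<Rightarrow> bool" where
  "transition_kernel P \<longleftrightarrow> P \<in> borel \<rightarrow>\<^sub>M prob_algebra borel"

text \<open>\<open>kernel_pow P n y\<close> is the \<open>n\<close>-step transition probability from \<open>y\<close>.\<close>

primrec kernel_pow :: "('y::topological_space \<Rightarrow> 'y measure) \<Rightarrow> nat \<Rightarrow> 'y \<Rightarrow> 'y measure" where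
  "kernel_pow P 0 = return borel"
| "kernel_pow P (Suc n) = (\<lambda>y. bind (P y) (kernel_pow P n))"

definition invariant_distribution :: "('y::topological_space \<Rightarrow> 'y measure) \<Rightarrow> 'y measure \<Rightarrow> bool" where
  "invariant_distribution P \<mu> \<longleftrightarrow> prob_space \<mu> \<and> sets \<mu> = sets borel \<and>
     (\<forall>A\<in>sets borel. emeasure \<mu> A = (\<integral>\<^sup>+y. emeasure (P y) A \<partial>\<mu>))"

definition irreducibility_measure :: "('y::topological_space \<Rightarrow> 'y measure) \<Rightarrow> 'y measure \<Rightarrow> bool" where
  "irreducibility_measure P \<phi> \<longleftrightarrow>
     sets \<phi> = sets borel \<and> sigma_finite_measure \<phi> \<and> emeasure \<phi> UNIV > 0 \<and>
     (\<forall>A\<in>sets borel. emeasure \<phi> A > 0 \<longrightarrow> (\<forall>y. \<exists>n\<ge>1. emeasure (kernel_pow P n y) A > 0))"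

text \<open>As in Meyn and Tweedie, the \<open>\<psi>\<close> in ``\<open>\<psi>\<close>-irreducible'' is a maximal irreducibility
  measure, i.e. one that dominates every other irreducibility measure.\<close>

definition psi_irreducible :: "('y::topological_space \<Rightarrow> 'y measure) \<Rightarrow> 'y measure \<Rightarrow> bool" where
  "psi_irreducible P \<psi> \<longleftrightarrow> irreducibility_measure P \<psi> \<and>
     (\<forall>\<phi>. irreducibility_measure P \<phi> \<longrightarrow> absolutely_continuous \<psi> \<phi>)"

definition cyclic_decomposition ::
  "('y::topological_space \<Rightarrow> 'y measure) \<Rightarrow> 'y measure \<Rightarrow> nat \<Rightarrow> (nat \<Rightarrow> 'y set) \<Rightarrow> bool" where
  "cyclic_decomposition P \<psi> r D \<longleftrightarrow>
     (\<forall>i<r. D i \<in> sets borel) \<and> disjoint_family_on D {..<r} \<and>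
     (\<forall>i<r. \<forall>y\<in>D i. emeasure (P y) (D (Suc i mod r)) = 1) \<and>
     emeasure \<psi> (UNIV - (\<Union>i<r. D i)) = 0"

text \<open>The period of a \<open>\<psi>\<close>-irreducible kernel is the largest length of a cycle that is full
  up to a \<open>\<psi>\<close>-null set; aperiodic means that it is 1.\<close>

definition aperiodic :: "('y::topological_space \<Rightarrow> 'y measure) \<Rightarrow> 'y measure \<Rightarrow> bool" where
  "aperiodic P \<psi> \<longleftrightarrow> \<not> (\<exists>r\<ge>2. \<exists>D. cyclic_decomposition P \<psi> r D)"


section \<open>Distance-like functions, Wasserstein-like functions, contraction coefficients\<close>

definition lower_semicontinuous :: "('a::topological_space \<Rightarrow> real) \<Rightarrow> bool" where
  "lower_semicontinuous f \<longleftrightarrow> (\<forall>a. open {x. a < f x})"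

definition distance_like :: "('y::topological_space \<Rightarrow> 'y \<Rightarrow> real) \<Rightarrow> bool" where
  "distance_like d \<longleftrightarrow>
     (\<forall>x y. 0 \<le> d x y) \<and> (\<forall>x y. d x y = d y x) \<and> (\<forall>x y. d x y = 0 \<longleftrightarrow> x = y) \<and>
     lower_semicontinuous (\<lambda>(x, y). d x y)"

definition couplings :: "'y::topological_space measure \<Rightarrow> 'y measure \<Rightarrow> ('y \<times> 'y) measure set" where
  "couplings \<mu>1 \<mu>2 = {\<xi>. prob_space \<xi> \<and> sets \<xi> = sets (borel \<Otimes>\<^sub>M borel) \<and>
     distr \<xi> borel fst = \<mu>1 \<and> distr \<xi> borel snd = \<mu>2}"

definition wasserstein_like ::
  "('y::topological_space \<Rightarrow> 'y \<Rightarrow> real) \<Rightarrow> 'y measure \<Rightarrow> 'y measure \<Rightarrow> ennreal" where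
  "wasserstein_like d \<mu>1 \<mu>2 = (INF \<xi>\<in>couplings \<mu>1 \<mu>2. \<integral>\<^sup>+(x, y). ennreal (d x y) \<partial>\<xi>)"

definition contraction_coeff ::
  "('y::topological_space \<Rightarrow> 'y \<Rightarrow> real) \<Rightarrow> ('y \<Rightarrow> 'y measure) \<Rightarrow> ennreal" where
  "contraction_coeff d Q =
     (SUP (y1, y2)\<in>{(y1, y2). y1 \<noteq> y2}. wasserstein_like d (Q y1) (Q y2) / ennreal (d y1 y2))"

definition lipschitz_wrt :: "('y \<Rightarrow> 'y \<Rightarrow> real) \<Rightarrow> real \<Rightarrow> ('y \<Rightarrow> real) \<Rightarrow> bool" where
  "lipschitz_wrt d L g \<longleftrightarrow> (\<forall>x y. \<bar>g x - g y\<bar> \<le> L * d x y)"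


section \<open>AIR MCMC chains\<close>

definition air_lag :: "real \<Rightarrow> nat \<Rightarrow> nat" where
  "air_lag \<beta> j = nat \<lceil>real j powr \<beta>\<rceil>"

definition air_time :: "real \<Rightarrow> nat \<Rightarrow> nat" where
  "air_time \<beta> m = (\<Sum>j=1..m. air_lag \<beta> j)"

text \<open>The state space is \<open>'x \<times> 'p\<close> with the product topology; by \<open>borel_prod\<close> its Borel
  sets are the product \<open>\<sigma>\<close>-algebra. The index set of the family is \<open>space I\<close>; nothing is assumed
  about \<open>\<pi> \<gamma>\<close> and \<open>P \<gamma>\<close> for other \<open>\<gamma>\<close>.\<close>

locale air_mcmc_setting =
  fixes \<nu> :: "'x::polish_space measure"
    and I :: "'i measure"
    and \<pi> :: "'i \<Rightarrow> ('x \<times> 'p::polish_space) measure"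
    and P :: "'i \<Rightarrow> 'x \<times> 'p \<Rightarrow> ('x \<times> 'p) measure"
  assumes prob_space_\<nu>: "prob_space \<nu>"
    and sets_\<nu>: "sets \<nu> = sets borel"
    and kernel: "\<And>\<gamma>. \<gamma> \<in> space I \<Longrightarrow> transition_kernel (P \<gamma>)"
    and kernel_jointly_measurable:
      "\<And>A. A \<in> sets borel \<Longrightarrow> (\<lambda>(y, \<gamma>). emeasure (P \<gamma> y) A) \<in> borel_measurable (borel \<Otimes>\<^sub>M I)"
    and invariant: "\<And>\<gamma>. \<gamma> \<in> space I \<Longrightarrow> invariant_distribution (P \<gamma>) (\<pi> \<gamma>)"
    and marginal: "\<And>\<gamma> B. \<gamma> \<in> space I \<Longrightarrow> B \<in> sets borel \<Longrightarrow> emeasure (\<pi> \<gamma>) (B \<times> UNIV) = emeasure \<nu> B"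
    and irreducible_aperiodic:
      "\<And>\<gamma>. \<gamma> \<in> space I \<Longrightarrow> \<exists>\<psi>. psi_irreducible (P \<gamma>) \<psi> \<and> aperiodic (P \<gamma>) \<psi>"

definition history ::
  "'w measure \<Rightarrow> 'i measure \<Rightarrow> (nat \<Rightarrow> 'w \<Rightarrow> 'y::topological_space) \<Rightarrow> (nat \<Rightarrow> 'w \<Rightarrow> 'i) \<Rightarrow> nat \<Rightarrow> 'w measure" where
  "history \<Omega> I Y \<Gamma> n = sigma (space \<Omega>)
     ({Y i -` B \<inter> space \<Omega> | i B. i \<le> n \<and> B \<in> sets borel} \<union>
      {\<Gamma> i -` B \<inter> space \<Omega> | i B. i \<le> n \<and> B \<in> sets I})"

locale air_mcmc_chain = air_mcmc_setting \<nu> I \<pi> P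
  for \<nu> :: "'x::polish_space measure"
    and I :: "'i measure"
    and \<pi> :: "'i \<Rightarrow> ('x \<times> 'p::polish_space) measure"
    and P :: "'i \<Rightarrow> 'x \<times> 'p \<Rightarrow> ('x \<times> 'p) measure" +
  fixes \<beta> :: real
    and \<Omega> :: "'w measure"
    and Y :: "nat \<Rightarrow> 'w \<Rightarrow> 'x \<times> 'p"
    and \<Gamma> :: "nat \<Rightarrow> 'w \<Rightarrow> 'i"
  assumes prob_space_\<Omega>: "prob_space \<Omega>"
    and measurable_Y: "\<And>n. Y n \<in> \<Omega> \<rightarrow>\<^sub>M borel"
    and measurable_\<Gamma>: "\<And>n. \<Gamma> n \<in> \<Omega> \<rightarrow>\<^sub>M I"
    and deterministic_start: "\<exists>y0 \<gamma>0. \<forall>\<omega>\<in>space \<Omega>. Y 0 \<omega> = y0 \<and> \<Gamma> 0 \<omega> = \<gamma>0"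
    and transition: "\<And>n B. B \<in> sets borel \<Longrightarrow>
      AE \<omega> in \<Omega>. real_cond_exp \<Omega> (history \<Omega> I Y \<Gamma> n) (\<lambda>\<omega>. indicator B (Y (Suc n) \<omega>)) \<omega>
        = measure (P (\<Gamma> n \<omega>) (Y n \<omega>)) B"
    and adaptation_rule: "\<exists>U. \<forall>n.
      U n \<in> (\<Pi>\<^sub>M i\<in>{..n}. borel) \<Otimes>\<^sub>M (\<Pi>\<^sub>M i\<in>{..<n}. I) \<rightarrow>\<^sub>M I \<and>
      (\<forall>\<omega>\<in>space \<Omega>. \<Gamma> n \<omega> = U n ((\<lambda>i\<in>{..n}. Y i \<omega>), (\<lambda>i\<in>{..<n}. \<Gamma> i \<omega>)))"
    and adaptation_times: "\<And>j i1 i2 \<omega>. \<omega> \<in> space \<Omega> \<Longrightarrow>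
      i1 \<in> {air_time \<beta> j..<air_time \<beta> (Suc j)} \<Longrightarrow> i2 \<in> {air_time \<beta> j..<air_time \<beta> (Suc j)} \<Longrightarrow>
      \<Gamma> i1 \<omega> = \<Gamma> i2 \<omega>"
    and measurable_\<pi>: "\<And>n g. g \<in> borel_measurable borel \<Longrightarrow>
      (\<And>\<gamma>. \<gamma> \<in> space I \<Longrightarrow> integrable (\<pi> \<gamma>) g) \<Longrightarrow>
      (\<lambda>\<omega>. \<integral>y. g y \<partial>\<pi> (\<Gamma> n \<omega>) :: real) \<in> borel_measurable \<Omega>"

end

theory Submission
  imports Defs "HOL-Real_Asymp.Real_Asymp"
begin

text \<open>
  Put \<open>g = h - \<nu> f\<close>. The Lipschitz constant of \<open>P\<^sub>\<gamma>\<^sup>k h\<close> decays geometrically in \<open>k\<close>, uniformly in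
  \<open>\<gamma>\<close>; since \<open>\<pi>\<^sub>\<gamma> g = 0\<close> and \<open>\<pi>\<^sub>\<gamma> V \<le> b / (1 - \<kappa>)\<close>, the series \<open>u\<^sub>\<gamma> = \<Sum>k. P\<^sub>\<gamma>\<^sup>k g\<close> solves the Poisson
  equation \<open>u\<^sub>\<gamma> - P\<^sub>\<gamma> u\<^sub>\<gamma> = g\<close> and is bounded by a multiple of \<open>V powr (1 / p)\<close>. Hence
  \<open>g (Y\<^sub>j) = [u (Y\<^sub>j\<^sub>+\<^sub>1) - P u (Y\<^sub>j)] + [u (Y\<^sub>j) - u (Y\<^sub>j\<^sub>+\<^sub>1)]\<close> with \<open>u\<close> and \<open>P\<close> taken at \<open>\<Gamma>\<^sub>j\<close>. The first
  brackets are orthogonal and bounded in \<open>L\<^sup>2\<close>, so their partial sums are \<open>O(n powr \<alpha>)\<close> almost surely for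
  every \<open>\<alpha> > 1 / 2\<close>. The second brackets telescope except at the \<open>O(n powr (1 / (1 + \<beta>)))\<close> adaptation
  times up to \<open>n\<close>, at each of which the error is \<open>O(n powr ((1 + \<delta>) / p))\<close> because
  \<open>\<Sum>j. V (Y\<^sub>j) / j powr (1 + \<delta>)\<close> has finite expectation.
\<close>

section \<open>Integration against kernels and almost sure bounds\<close>

text \<open>Nothing is assumed about how \<open>P\<close> varies with the parameter, so Poisson
  solutions for different parameters cannot be compared. Each change of parameter is therefore
  charged with the full size of two Poisson solutions, and only the rarity of the changes keeps the
  total small. This is the origin of the threshold: the exponent \<open>1 / (1 + \<beta>)\<close>
  counts the changes, \<open>1 / p\<close> is the size of one of them, and \<open>1 / 2\<close> is
  the exponent of the orthogonal sums, which cannot be undercut and so gives the \<open>0\<close> in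
  the maximum.

  The weight \<open>V powr (1 / p)\<close> is kept apart from \<open>V\<close>. Its square is at
  most \<open>V\<close>, whose expectation along the chain is bounded, so the first brackets are
  square integrable; with the weight \<open>V\<close> itself neither this nor the exponent
  \<open>1 / p\<close> would come out.

  Unbounded integrands and a random parameter also require care: integrability has to be known
  before Bochner integrals are exchanged, and the Poisson solutions must be measurable jointly in
  state and parameter. All growth bounds are pathwise, with a constant that merely exists for almost
  every \<open>\<omega>\<close>; measurability of the constant is arranged once, at the end.\<close>

lemma integral_bind_integrable:
  fixes f :: "'b \<Rightarrow> real"
  assumes N[measurable]: "N \<in> M \<rightarrow>\<^sub>M subprob_algebra B"
    and f: "f \<in> borel_measurable B" and int: "integrable (M \<bind> N) f"
  shows "(\<integral>x. f x \<partial>(M \<bind> N)) = (\<integral>x. (\<integral>y. f y \<partial>N x) \<partial>M)"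
proof -
  note f[measurable]
  define p where "p x = (\<integral>\<^sup>+y. ennreal (f y) \<partial>N x)" for x
  define n where "n x = (\<integral>\<^sup>+y. ennreal (- f y) \<partial>N x)" for x
  have [measurable]: "p \<in> borel_measurable M" "n \<in> borel_measurable M"
    unfolding p_def n_def by measurable
  have pn: "(\<integral>\<^sup>+x. ennreal (f x) \<partial>(M \<bind> N)) = (\<integral>\<^sup>+x. p x \<partial>M)"
    "(\<integral>\<^sup>+x. ennreal (- f x) \<partial>(M \<bind> N)) = (\<integral>\<^sup>+x. n x \<partial>M)"
    unfolding p_def n_def by (subst nn_integral_bind[OF _ N]; simp)+
  have fin: "(\<integral>\<^sup>+x. p x \<partial>M) \<noteq> \<infinity>" "(\<integral>\<^sup>+x. n x \<partial>M) \<noteq> \<infinity>"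
    using int unfolding real_integrable_def pn by auto
  have ae: "AE x in M. p x \<noteq> \<infinity>" "AE x in M. n x \<noteq> \<infinity>"
    by (rule nn_integral_PInf_AE; use fin in simp)+
  have e: "(\<integral>\<^sup>+x. ennreal (enn2real (p x)) \<partial>M) = (\<integral>\<^sup>+x. p x \<partial>M)"
    "(\<integral>\<^sup>+x. ennreal (enn2real (n x)) \<partial>M) = (\<integral>\<^sup>+x. n x \<partial>M)"
    using ae by (auto intro!: nn_integral_cong_AE simp: less_top)
  have i: "integrable M (\<lambda>x. enn2real (p x))" "integrable M (\<lambda>x. enn2real (n x))"
    using fin by (auto intro!: integrableI_nonneg simp: e less_top)
  have *: "AE x in M. (\<integral>y. f y \<partial>N x) = enn2real (p x) - enn2real (n x)"
    using ae AE_space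
  proof eventually_elim
    case (elim x)
    then have "f \<in> borel_measurable (N x)"
      using f measurable_cong_sets[OF sets_kernel[OF N elim(3)] refl] by blast
    then have "integrable (N x) f"
      using elim unfolding real_integrable_def p_def n_def by auto
    then show ?case
      unfolding p_def n_def by (rule real_lebesgue_integral_def)
  qed
  have [measurable]: "(\<lambda>x. \<integral>y. f y \<partial>N x) \<in> borel_measurable M"
    using measurable_compose[OF N integral_measurable_subprob_algebra[OF f]] by simp
  have "(\<integral>x. f x \<partial>(M \<bind> N)) = enn2real (\<integral>\<^sup>+x. p x \<partial>M) - enn2real (\<integral>\<^sup>+x. n x \<partial>M)"
    using real_lebesgue_integral_def[OF int] unfolding pn .
  also have "\<dots> = (\<integral>x. enn2real (p x) \<partial>M) - (\<integral>x. enn2real (n x) \<partial>M)"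
    by (simp add: integral_eq_nn_integral e)
  also have "\<dots> = (\<integral>x. enn2real (p x) - enn2real (n x) \<partial>M)"
    using i by simp
  also have "\<dots> = (\<integral>x. (\<integral>y. f y \<partial>N x) \<partial>M)"
    using * by (intro integral_cong_AE) auto
  finally show ?thesis .
qed

text \<open>The hypothesis \<open>eq\<close> is the equality on rectangles
  \<open>A \<times> B\<close>, an intersection-stable generator of the product. Keeping
  \<open>\<omega>\<close> itself as first coordinate, with the sigma-algebra \<open>F\<close>,
  records the whole past next to \<open>X\<close>.\<close>

lemma distr_pair_eq_bind_kernel:
  assumes "prob_space M" and sub: "subalgebra M F"
    and X[measurable]: "X \<in> M \<rightarrow>\<^sub>M N" and Q[measurable]: "Q \<in> F \<rightarrow>\<^sub>M prob_algebra N"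
    and eq: "\<forall>A\<in>sets F. \<forall>B\<in>sets N.
      emeasure M (A \<inter> (X -` B \<inter> space M)) = (\<integral>\<^sup>+\<omega>. emeasure (Q \<omega>) B * indicator A \<omega> \<partial>M)"
  shows "(\<lambda>\<omega>. distr (Q \<omega>) (F \<Otimes>\<^sub>M N) (Pair \<omega>)) \<in> M \<rightarrow>\<^sub>M prob_algebra (F \<Otimes>\<^sub>M N)" (is ?meas)
    and "distr M (F \<Otimes>\<^sub>M N) (\<lambda>\<omega>. (\<omega>, X \<omega>)) =
      M \<bind> (\<lambda>\<omega>. distr (Q \<omega>) (F \<Otimes>\<^sub>M N) (Pair \<omega>))" (is "?L = ?R")
proof -
  interpret prob_space M by fact
  have sp: "space M = space F" using sub by (simp add: subalgebra_def)
  have id: "(\<lambda>x. x) \<in> M \<rightarrow>\<^sub>M F"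
    using sub by (auto simp: subalgebra_def measurable_def)
  have 1: "(\<lambda>\<omega>. distr (Q \<omega>) (F \<Otimes>\<^sub>M N) (Pair \<omega>)) \<in> F \<rightarrow>\<^sub>M prob_algebra (F \<Otimes>\<^sub>M N)"
    by (rule measurable_distr_prob_space2[where M=N]) (auto simp: Q)
  show meas: ?meas
    using measurable_compose[OF id 1] by simp
  have QM: "Q \<in> M \<rightarrow>\<^sub>M prob_algebra N" using measurable_compose[OF id Q] by simp
  have XM: "(\<lambda>\<omega>. (\<omega>, X \<omega>)) \<in> M \<rightarrow>\<^sub>M F \<Otimes>\<^sub>M N" using id by measurable
  have L: "prob_space ?L" by (rule prob_space_distr[OF XM])
  have Ms: "M \<in> space (prob_algebra M)" by (simp add: space_prob_algebra prob_space_axioms)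
  have setsR: "sets ?R = sets (F \<Otimes>\<^sub>M N)"
    by (rule sets_bind'[OF Ms meas])
  show "?L = ?R"
  proof (rule measure_eqI_generator_eq[where E="{a \<times> b | a b. a \<in> sets F \<and> b \<in> sets N}"
        and \<Omega>="space F \<times> space N" and A="\<lambda>_. space F \<times> space N"])
    show "Int_stable {a \<times> b | a b. a \<in> sets F \<and> b \<in> sets N}"
      by (rule Int_stable_pair_measure_generator)
    show "{a \<times> b | a b. a \<in> sets F \<and> b \<in> sets N} \<subseteq> Pow (space F \<times> space N)"
      by (rule pair_measure_closed)
    show "sets ?L = sigma_sets (space F \<times> space N) {a \<times> b | a b. a \<in> sets F \<and> b \<in> sets N}"
      by (simp add: sets_pair_measure)
    show "sets ?R = sigma_sets (space F \<times> space N) {a \<times> b | a b. a \<in> sets F \<and> b \<in> sets N}"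
      by (simp add: setsR sets_pair_measure)
    show "range (\<lambda>_. space F \<times> space N) \<subseteq> {a \<times> b | a b. a \<in> sets F \<and> b \<in> sets N}" by auto
    show "(\<Union>i::nat. space F \<times> space N) = space F \<times> space N" by auto
    show "emeasure ?L (space F \<times> space N) \<noteq> \<infinity>" for i :: nat
      using L finite_measure.emeasure_finite[of ?L] by (auto simp: prob_space_def)
    fix C assume "C \<in> {a \<times> b | a b. a \<in> sets F \<and> b \<in> sets N}"
    then obtain A B where C: "C = A \<times> B" and [measurable]: "A \<in> sets F" "B \<in> sets N" by auto
    have "emeasure ?L C = emeasure M (A \<inter> (X -` B \<inter> space M))"
      unfolding C using XM sp sets.sets_into_space[OF \<open>A \<in> sets F\<close>]
      by (subst emeasure_distr) (auto intro!: arg_cong[where f="emeasure M"])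
    also have "\<dots> = (\<integral>\<^sup>+\<omega>. emeasure (Q \<omega>) B * indicator A \<omega> \<partial>M)"
      using eq by simp
    also have "\<dots> = (\<integral>\<^sup>+\<omega>. emeasure (distr (Q \<omega>) (F \<Otimes>\<^sub>M N) (Pair \<omega>)) C \<partial>M)"
    proof (rule nn_integral_cong)
      fix \<omega> assume w: "\<omega> \<in> space M"
      have s: "sets (Q \<omega>) = sets N"
        using measurable_space[OF QM w] by (simp add: space_prob_algebra)
      have P: "Pair \<omega> \<in> Q \<omega> \<rightarrow>\<^sub>M F \<Otimes>\<^sub>M N"
        using w sp unfolding measurable_cong_sets[OF s refl] by (intro measurable_Pair1') simp
      have "Pair \<omega> -` C \<inter> space (Q \<omega>) = (if \<omega> \<in> A then B else {})"
        using sets.sets_into_space[OF \<open>B \<in> sets N\<close>] sets_eq_imp_space_eq[OF s] by (auto simp: C)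
      then show "emeasure (Q \<omega>) B * indicator A \<omega> = emeasure (distr (Q \<omega>) (F \<Otimes>\<^sub>M N) (Pair \<omega>)) C"
        by (subst emeasure_distr[OF P]) (auto simp: C)
    qed
    also have "\<dots> = emeasure ?R C"
      by (rule emeasure_bind_prob_algebra[OF Ms meas, symmetric]) (auto simp: C)
    finally show "emeasure ?L C = emeasure ?R C" .
  qed
qed

text \<open>The sum of all \<open>W n\<close> has finite expectation, hence is finite almost surely,
  and it dominates each of its nonnegative terms.\<close>

lemma AE_bounded_if_summable_expectation:
  fixes W :: "nat \<Rightarrow> 'a \<Rightarrow> real"
  assumes [measurable]: "\<And>n. W n \<in> borel_measurable M"
    and nonneg: "\<And>n x. 0 \<le> W n x"
    and le: "\<And>n. (\<integral>\<^sup>+x. ennreal (W n x) \<partial>M) \<le> ennreal (w n)"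
    and w: "summable w" "\<And>n. 0 \<le> w n"
  shows "AE x in M. \<exists>c. \<forall>n. W n x \<le> c"
proof -
  have "(\<integral>\<^sup>+x. (\<Sum>n. ennreal (W n x)) \<partial>M) = (\<Sum>n. \<integral>\<^sup>+x. ennreal (W n x) \<partial>M)"
    by (rule nn_integral_suminf) simp
  also have "\<dots> \<le> (\<Sum>n. ennreal (w n))"
    by (rule suminf_le) (auto intro: le)
  also have "\<dots> = ennreal (suminf w)"
    using w by (simp add: suminf_ennreal2)
  finally have "(\<integral>\<^sup>+x. (\<Sum>n. ennreal (W n x)) \<partial>M) \<noteq> \<infinity>"
    by (auto simp: top_unique)
  then have "AE x in M. (\<Sum>n. ennreal (W n x)) \<noteq> \<infinity>"
    by (intro nn_integral_PInf_AE) auto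
  then show ?thesis
  proof eventually_elim
    case (elim x)
    have "W n x \<le> enn2real (\<Sum>n. ennreal (W n x))" for n
    proof -
      have "ennreal (W n x) \<le> (\<Sum>n. ennreal (W n x))"
        using sum_le_suminf[of "\<lambda>n. ennreal (W n x)" "{n}"] by simp
      then have "enn2real (ennreal (W n x)) \<le> enn2real (\<Sum>n. ennreal (W n x))"
        using elim by (intro enn2real_mono) (simp_all add: less_top)
      then show ?thesis using nonneg by simp
    qed
    then show ?case by blast
  qed
qed

text \<open>The best constant is the supremum of the normalised values, a countable supremum and so
  measurable. It is formed in \<open>ennreal\<close>, where it always exists;
  \<open>enn2real\<close> spoils it only where it is infinite, which is a null set.\<close>

lemma measurable_bound_exists:
  fixes X :: "nat \<Rightarrow> 'a \<Rightarrow> real"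
  assumes [measurable]: "\<And>n. X n \<in> borel_measurable M"
    and pos: "\<And>n. n \<ge> 1 \<Longrightarrow> 0 < r n"
    and ae: "AE x in M. \<exists>c. \<forall>n\<ge>1. \<bar>X n x\<bar> \<le> r n * c"
  shows "\<exists>C\<in>borel_measurable M. AE x in M. \<forall>n\<ge>1. \<bar>X n x\<bar> \<le> r n * C x"
proof (intro bexI)
  define S where "S x = (SUP n\<in>{1..}. ennreal (\<bar>X n x\<bar> / r n))" for x
  show "(\<lambda>x. enn2real (S x)) \<in> borel_measurable M"
    unfolding S_def by measurable
  show "AE x in M. \<forall>n\<ge>1. \<bar>X n x\<bar> \<le> r n * enn2real (S x)"
    using ae
  proof eventually_elim
    case (elim x)
    then obtain c where c: "\<And>n. n \<ge> 1 \<Longrightarrow> \<bar>X n x\<bar> \<le> r n * c" by blast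
    have "S x \<le> ennreal c"
      unfolding S_def using c pos
      by (intro SUP_least ennreal_leI) (auto simp: divide_simps mult.commute)
    then have fin: "S x \<noteq> \<infinity>" by (auto simp: top_unique)
    show ?case
    proof (intro allI impI)
      fix n :: nat assume n: "n \<ge> 1"
      have "ennreal (\<bar>X n x\<bar> / r n) \<le> S x"
        unfolding S_def using n by (intro SUP_upper) auto
      then have "enn2real (ennreal (\<bar>X n x\<bar> / r n)) \<le> enn2real (S x)"
        using fin by (intro enn2real_mono) (simp_all add: less_top)
      then have "\<bar>X n x\<bar> / r n \<le> enn2real (S x)"
        using pos[OF n] by simp
      then show "\<bar>X n x\<bar> \<le> r n * enn2real (S x)"
        using pos[OF n] by (simp add: divide_simps mult.commute)
    qed
  qed
qed

text \<open>The sum of the squares of all dyadic block sums of \<open>D a, \<dots>, D (a + 2 ^ k - 1)\<close>. It controls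
  all partial sums at once in the manner of Rademacher and Menshov, so that a rate for orthogonal
  sums needs neither a maximal inequality nor a filtration.\<close>

primrec dyadic_energy :: "(nat \<Rightarrow> real) \<Rightarrow> nat \<Rightarrow> nat \<Rightarrow> real" where
  "dyadic_energy D 0 a = (D a)\<^sup>2"
| "dyadic_energy D (Suc k) a =
    (\<Sum>i<2 ^ Suc k. D (a + i))\<^sup>2 + dyadic_energy D k a + dyadic_energy D k (a + 2 ^ k)"

lemma dyadic_energy_nonneg: "0 \<le> dyadic_energy D k a"
  by (induction k arbitrary: a) (auto intro!: add_nonneg_nonneg)

lemma block_sum_sq_le_dyadic_energy: "(\<Sum>i<2 ^ k. D (a + i))\<^sup>2 \<le> dyadic_energy D k a"
  by (cases k) (auto simp: dyadic_energy_nonneg)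

text \<open>A partial sum that reaches past the middle is the complete left block plus a partial sum
  of the right half. Iterating gives at most \<open>k + 1\<close> dyadic blocks, and
  \<open>k + 1\<close> is the resulting Cauchy-Schwarz factor.\<close>

lemma partial_sum_sq_le_dyadic_energy:
  "n \<le> 2 ^ k \<Longrightarrow> (\<Sum>i<n. D (a + i))\<^sup>2 \<le> real (k + 1) * dyadic_energy D k a"
proof (induction k arbitrary: n a)
  case 0
  then have "n = 0 \<or> n = 1" by auto
  then show ?case by auto
next
  case (Suc k)
  define E where "E = dyadic_energy D k a"
  define E' where "E' = dyadic_energy D k (a + 2 ^ k)"
  have nn: "0 \<le> E" "0 \<le> E'" by (auto simp: E_def E'_def dyadic_energy_nonneg)
  have "(\<Sum>i<n. D (a + i))\<^sup>2 \<le> real (k + 2) * (E + E')"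
  proof (cases "n \<le> 2 ^ k")
    case True
    then have "(\<Sum>i<n. D (a + i))\<^sup>2 \<le> real (k + 1) * E"
      using Suc.IH[of n a] by (simp add: E_def)
    also have "\<dots> \<le> real (k + 2) * (E + E')"
      using nn by (intro mult_mono) auto
    finally show ?thesis .
  next
    case False
    define x where "x = (\<Sum>i<2 ^ k. D (a + i))"
    define y where "y = (\<Sum>i<n - 2 ^ k. D (a + 2 ^ k + i))"
    have "(\<Sum>i<n. D (a + i)) = x + y"
    proof -
      have "(\<Sum>i<m + l. D (a + i)) = (\<Sum>i<m. D (a + i)) + (\<Sum>i<l. D (a + m + i))" for m l
        by (induction l) (auto simp: add.assoc)
      from this[of "2 ^ k" "n - 2 ^ k"] show ?thesis
        using False by (simp add: x_def y_def)
    qed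
    have x: "x\<^sup>2 \<le> E"
      unfolding x_def E_def by (rule block_sum_sq_le_dyadic_energy)
    have y: "y\<^sup>2 \<le> real (k + 1) * E'"
      unfolding y_def E'_def using Suc.prems by (intro Suc.IH) auto
    \<comment> \<open>Young's inequality with weight \<open>s\<close> balances the two parts: the
      left block gets \<open>s + 1\<close>, and the right half gets
      \<open>(1 + 1 / s) * s = s + 1\<close>, so each level raises the factor by one.\<close>
    define s where "s = real (k + 1)"
    have s: "s > 0" by (simp add: s_def)
    have "0 \<le> (s * x - y)\<^sup>2 / s" using s by simp
    also have "(s * x - y)\<^sup>2 / s = s * x\<^sup>2 - 2 * x * y + y\<^sup>2 / s"
      using s by (simp add: field_simps power2_eq_square)
    finally have "(x + y)\<^sup>2 \<le> (s + 1) * x\<^sup>2 + (1 + 1 / s) * y\<^sup>2"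
      by (simp add: field_simps power2_eq_square)
    also have "\<dots> \<le> (s + 1) * E + (1 + 1 / s) * (s * E')"
      using x y s by (intro add_mono mult_left_mono) (auto simp: s_def)
    also have "\<dots> = (s + 1) * (E + E')" using s by (simp add: field_simps)
    finally show ?thesis
      using \<open>(\<Sum>i<n. D (a + i)) = x + y\<close> by (simp add: s_def algebra_simps)
  qed
  also have "\<dots> \<le> real (Suc k + 1) * dyadic_energy D (Suc k) a"
    by (auto simp: E_def E'_def algebra_simps intro!: mult_left_mono)
  finally show ?case .
qed

text \<open>Orthogonality bounds the expected square of a block sum by the block length times
  \<open>c\<close>. The blocks of one level partition the \<open>2 ^ k\<close> indices, so each of
  the \<open>k + 1\<close> levels contributes at most \<open>2 ^ k * c\<close>.\<close>

lemma dyadic_energy_integral: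
  fixes D :: "nat \<Rightarrow> 'a \<Rightarrow> real"
  assumes int: "\<And>i j. integrable M (\<lambda>x. D i x * D j x)"
    and orth: "\<And>i j. i < j \<Longrightarrow> (\<integral>x. D i x * D j x \<partial>M) = 0"
    and le: "\<And>i. (\<integral>x. D i x * D i x \<partial>M) \<le> c"
  shows "integrable M (\<lambda>x. dyadic_energy (\<lambda>i. D i x) k a)"
    and "(\<integral>x. dyadic_energy (\<lambda>i. D i x) k a \<partial>M) \<le> real (k + 1) * 2 ^ k * c"
proof -
  have orth': "(\<integral>x. D i x * D j x \<partial>M) = (if i = j then (\<integral>x. D i x * D i x \<partial>M) else 0)" for i j
    using orth[of i j] orth[of j i] by (cases i j rule: linorder_cases) (auto simp: mult.commute)
  have sq: "(\<Sum>i<n. D (a + i) x)\<^sup>2 = (\<Sum>i<n. \<Sum>j<n. D (a + i) x * D (a + j) x)" for n a x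
    by (simp add: power2_eq_square sum_product)
  have i1: "integrable M (\<lambda>x. (\<Sum>i<n. D (a + i) x)\<^sup>2)" for n a
    unfolding sq by (intro Bochner_Integration.integrable_sum int)
  have i2: "(\<integral>x. (\<Sum>i<n. D (a + i) x)\<^sup>2 \<partial>M) \<le> real n * c" for n a
  proof -
    have "(\<integral>x. (\<Sum>i<n. D (a + i) x)\<^sup>2 \<partial>M) = (\<Sum>i<n. \<Sum>j<n. \<integral>x. D (a + i) x * D (a + j) x \<partial>M)"
      unfolding sq by (simp add: Bochner_Integration.integral_sum int)
    also have "\<dots> = (\<Sum>i<n. \<integral>x. D (a + i) x * D (a + i) x \<partial>M)"
      by (subst orth') (simp add: sum.delta')
    also have "\<dots> \<le> (\<Sum>i<n. c)" by (intro sum_mono le)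
    finally show ?thesis by simp
  qed
  have "integrable M (\<lambda>x. dyadic_energy (\<lambda>i. D i x) k a) \<and>
    (\<integral>x. dyadic_energy (\<lambda>i. D i x) k a \<partial>M) \<le> real (k + 1) * 2 ^ k * c"
  proof (induction k arbitrary: a)
    case 0
    then show ?case using int[of a a] le[of a] by (simp add: power2_eq_square)
  next
    case (Suc k)
    have "(\<integral>x. dyadic_energy (\<lambda>i. D i x) (Suc k) a \<partial>M) =
      (\<integral>x. (\<Sum>i<2 ^ Suc k. D (a + i) x)\<^sup>2 \<partial>M) + (\<integral>x. dyadic_energy (\<lambda>i. D i x) k a \<partial>M)
        + (\<integral>x. dyadic_energy (\<lambda>i. D i x) k (a + 2 ^ k) \<partial>M)"
      unfolding dyadic_energy.simps using Suc.IH i1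
      by (simp add: Bochner_Integration.integral_add Bochner_Integration.integrable_add)
    also have "\<dots> \<le> real (2 ^ Suc k) * c + real (k + 1) * 2 ^ k * c + real (k + 1) * 2 ^ k * c"
      using Suc.IH by (intro add_mono i2) auto
    also have "\<dots> = real (Suc k + 1) * 2 ^ Suc k * c" by (simp add: algebra_simps)
    finally have "(\<integral>x. dyadic_energy (\<lambda>i. D i x) (Suc k) a \<partial>M) \<le> real (Suc k + 1) * 2 ^ Suc k * c" .
    moreover have "integrable M (\<lambda>x. dyadic_energy (\<lambda>i. D i x) (Suc k) a)"
      unfolding dyadic_energy.simps using Suc.IH i1 by (intro Bochner_Integration.integrable_add) auto
    ultimately show ?case by blast
  qed
  then show "integrable M (\<lambda>x. dyadic_energy (\<lambda>i. D i x) k a)"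
    and "(\<integral>x. dyadic_energy (\<lambda>i. D i x) k a \<partial>M) \<le> real (k + 1) * 2 ^ k * c" by blast+
qed

lemma summable_square_geometric:
  fixes q :: real
  assumes "0 \<le> q" "q < 1"
  shows "summable (\<lambda>k. (real (k + 1))\<^sup>2 * q ^ k)"
proof -
  have "(\<lambda>k. (real k + 2)\<^sup>2 / (real k + 1)\<^sup>2) \<longlonglongrightarrow> 1" by real_asymp
  then have "(\<lambda>k. (real k + 2)\<^sup>2 / (real k + 1)\<^sup>2 * q) \<longlonglongrightarrow> 1 * q"
    by (intro tendsto_mult tendsto_const)
  then have "eventually (\<lambda>k. (real k + 2)\<^sup>2 / (real k + 1)\<^sup>2 * q < (1 + q) / 2) sequentially"
    using assms by (intro order_tendstoD(2)) auto
  then obtain N where N: "\<And>k. k \<ge> N \<Longrightarrow> (real k + 2)\<^sup>2 / (real k + 1)\<^sup>2 * q < (1 + q) / 2"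
    by (auto simp: eventually_sequentially)
  show ?thesis
  proof (rule summable_ratio_test[where c="(1 + q) / 2" and N=N])
    fix k assume "k \<ge> N"
    then have "(real k + 2)\<^sup>2 * q \<le> (1 + q) / 2 * (real k + 1)\<^sup>2"
      using N[of k] by (simp add: divide_simps split: if_splits)
    then have "((real k + 2)\<^sup>2 * q) * q ^ k \<le> ((1 + q) / 2 * (real k + 1)\<^sup>2) * q ^ k"
      using assms by (intro mult_right_mono) auto
    moreover have "real (Suc k + 1) = real k + 2" "real (k + 1) = real k + 1" by auto
    ultimately show "norm ((real (Suc k + 1))\<^sup>2 * q ^ Suc k) \<le> (1 + q) / 2 * norm ((real (k + 1))\<^sup>2 * q ^ k)"
      using assms by (simp only: norm_mult norm_power real_norm_def power_Suc abs_of_nonneg mult.assoc power_abs power2_abs) 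
        (simp add: algebra_simps)
  qed (use assms in auto)
qed

text \<open>The normalised energies \<open>W k\<close> have expectation at most
  \<open>(k + 1)^2 * q ^ k * c\<close>, and \<open>q < 1\<close> is precisely
  \<open>\<alpha> > 1 / 2\<close>. One factor \<open>k + 1\<close> counts the levels in the energy,
  the other comes from the estimate of partial sums; the geometric factor absorbs both.\<close>

lemma orthogonal_sum_growth:
  fixes D :: "nat \<Rightarrow> 'a \<Rightarrow> real"
  assumes int: "\<And>i j. integrable M (\<lambda>x. D i x * D j x)"
    and orth: "\<And>i j. i < j \<Longrightarrow> (\<integral>x. D i x * D j x \<partial>M) = 0"
    and le: "\<And>i. (\<integral>x. D i x * D i x \<partial>M) \<le> c"
    and \<alpha>: "\<alpha> > 1 / 2"
  shows "AE x in M. \<exists>C. \<forall>n\<ge>1. \<bar>\<Sum>i<n. D i x\<bar> \<le> C * real n powr \<alpha>"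
proof -
  define E where "E k x = dyadic_energy (\<lambda>i. D i x) k 0" for k x
  define q where "q = 2 powr (1 - 2 * \<alpha>)"
  define W where "W k x = real (k + 1) * E k x / (2 powr (2 * \<alpha>)) ^ k" for k x
  have q: "0 < q" "q < 1" using \<alpha> by (auto simp: q_def powr_less_one)
  have c: "0 \<le> c" using le[of 0] by (rule order_trans[rotated]) auto
  have q2: "2 ^ k / (2 powr (2 * \<alpha>)) ^ k = q ^ k" for k
    by (simp add: q_def powr_diff power_divide)
  have Ei: "integrable M (E k)" and El: "(\<integral>x. E k x \<partial>M) \<le> real (k + 1) * 2 ^ k * c" for k
    unfolding E_def using dyadic_energy_integral[where D=D, OF int orth le] by blast+
  have E0: "0 \<le> E k x" for k x by (simp add: E_def dyadic_energy_nonneg)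
  have "AE x in M. \<exists>C. \<forall>k. W k x \<le> C"
  proof (rule AE_bounded_if_summable_expectation)
    show "W k \<in> borel_measurable M" for k
      using borel_measurable_integrable[OF Ei[of k]] unfolding W_def by measurable
    show "0 \<le> W k x" for k x using E0 by (auto simp: W_def)
    show "summable (\<lambda>k. (real (k + 1))\<^sup>2 * q ^ k * c)"
      using summable_square_geometric[of q] q by (intro summable_mult2) auto
    show "0 \<le> (real (k + 1))\<^sup>2 * q ^ k * c" for k using q c by auto
    fix k
    have "(\<integral>\<^sup>+x. ennreal (W k x) \<partial>M) = ennreal (\<integral>x. W k x \<partial>M)"
      using Ei[of k] E0 unfolding W_def by (intro nn_integral_eq_integral) auto
    also have "(\<integral>x. W k x \<partial>M) = real (k + 1) / (2 powr (2 * \<alpha>)) ^ k * (\<integral>x. E k x \<partial>M)"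
      unfolding W_def by simp
    also have "\<dots> \<le> real (k + 1) / (2 powr (2 * \<alpha>)) ^ k * (real (k + 1) * 2 ^ k * c)"
      using El by (intro mult_left_mono) auto
    also have "\<dots> = (real (k + 1))\<^sup>2 * (2 ^ k / (2 powr (2 * \<alpha>)) ^ k) * c"
      by (simp add: power2_eq_square)
    finally show "(\<integral>\<^sup>+x. ennreal (W k x) \<partial>M) \<le> ennreal ((real (k + 1))\<^sup>2 * q ^ k * c)"
      unfolding q2 by (simp add: ennreal_leI)
  qed
  then show ?thesis
  proof eventually_elim
    case (elim x)
    then obtain C where C: "\<And>k. W k x \<le> C" by blast
    have C0: "0 \<le> C" using C[of 0] E0[of 0 x] by (simp add: W_def)
    show ?case
    proof (intro exI allI impI)
      fix n :: nat assume n: "n \<ge> 1"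
      \<comment> \<open>The least dyadic length covering \<open>n\<close> overshoots by at most a
        factor of 2, which reappears as \<open>2 powr \<alpha>\<close> in the constant.\<close>
      define k where "k = (LEAST k. n \<le> 2 ^ k)"
      have nk: "n \<le> 2 ^ k"
        unfolding k_def by (rule LeastI[of _ n]) (simp add: less_imp_le)
      have k2: "2 ^ k \<le> 2 * n"
      proof (cases k)
        case (Suc k')
        then have "\<not> n \<le> 2 ^ k'"
          using not_less_Least[of k' "\<lambda>k. n \<le> 2 ^ k"] by (simp add: k_def)
        then show ?thesis using Suc by simp
      qed (use n in auto)
      have "(\<Sum>i<n. D i x)\<^sup>2 \<le> real (k + 1) * E k x"
        using partial_sum_sq_le_dyadic_energy[OF nk, of "\<lambda>i. D i x" 0] by (simp add: E_def)
      also have "\<dots> = W k x * (2 powr (2 * \<alpha>)) ^ k" by (simp add: W_def)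
      also have "\<dots> \<le> C * (2 powr (2 * \<alpha>)) ^ k"
        using C by (intro mult_right_mono) auto
      also have "(2 powr (2 * \<alpha>)) ^ k = (2 ^ k) powr (2 * \<alpha>)"
        by (simp add: powr_realpow[symmetric] powr_powr mult.commute)
      also have "C * \<dots> \<le> C * (2 * real n) powr (2 * \<alpha>)"
      proof -
        have "2 ^ k \<le> 2 * real n"
          using k2 by (metis of_nat_le_iff of_nat_mult of_nat_numeral of_nat_power)
        then show ?thesis using \<alpha> C0 by (intro mult_left_mono powr_mono2) auto
      qed
      also have "(2 * real n) powr (2 * \<alpha>) = ((2 * real n) powr \<alpha>)\<^sup>2"
        unfolding power2_eq_square powr_add[symmetric] mult_2 ..
      also have "C * \<dots> = (sqrt C * (2 powr \<alpha>) * real n powr \<alpha>)\<^sup>2"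
        using C0 by (simp only: power_mult_distrib powr_mult real_sqrt_pow2 mult.assoc)
      finally have "\<bar>\<Sum>i<n. D i x\<bar> \<le> \<bar>(sqrt C * (2 powr \<alpha>)) * real n powr \<alpha>\<bar>"
        unfolding abs_le_square_iff .
      also have "\<dots> = (sqrt C * (2 powr \<alpha>)) * real n powr \<alpha>"
        using C0 by (intro abs_of_nonneg mult_nonneg_nonneg) auto
      finally show "\<bar>\<Sum>i<n. D i x\<bar> \<le> (sqrt C * (2 powr \<alpha>)) * real n powr \<alpha>" .
    qed
  qed
qed


section \<open>Transition kernels: contraction, drift and the Poisson equation\<close>

definition kernel_operator :: "('y \<Rightarrow> 'y measure) \<Rightarrow> ('y \<Rightarrow> real) \<Rightarrow> 'y \<Rightarrow> real" where
  "kernel_operator Q g y = (\<integral>y'. g y' \<partial>Q y)"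

text \<open>The Neumann series for the inverse of the identity minus \<open>Q\<close>. As a
  pointwise \<open>suminf\<close> it is measurable, also in a parameter of \<open>Q\<close>,
  whenever its terms are; convergence is a separate matter.\<close>

definition poisson_solution :: "('y \<Rightarrow> 'y measure) \<Rightarrow> ('y \<Rightarrow> real) \<Rightarrow> 'y \<Rightarrow> real" where
  "poisson_solution Q g y = (\<Sum>k. (kernel_operator Q ^^ k) g y)"

lemma transition_kernelD:
  assumes "transition_kernel Q"
  shows "prob_space (Q y)" "sets (Q y) = sets borel" "space (Q y) = UNIV"
proof -
  have "Q y \<in> space (prob_algebra borel)"
    using assms by (auto simp: transition_kernel_def dest: measurable_space)
  then show "prob_space (Q y)" "sets (Q y) = sets borel"
    by (auto simp: space_prob_algebra)
  then show "space (Q y) = UNIV"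
    using sets_eq_imp_space_eq[of "Q y" borel] by simp
qed

lemma transition_kernel_pow:
  assumes "transition_kernel Q"
  shows "transition_kernel (kernel_pow Q n)"
proof (induction n)
  case 0
  then show ?case by (simp add: transition_kernel_def)
next
  case (Suc n)
  then show ?case
    using assms measurable_bind_prob_space[of Q borel borel "kernel_pow Q n" borel]
    by (simp add: transition_kernel_def)
qed

text \<open>Contraction is used on functions: the operator shrinks Lipschitz constants, which iterates
  without composing couplings (the \<open>d\<close>-triangle inequality is not available).\<close>

lemma lipschitz_wrt_kernel_operator:
  fixes d :: "'y::second_countable_topology \<Rightarrow> 'y \<Rightarrow> real"
  assumes d: "distance_like d" and R: "transition_kernel R"
    and g: "g \<in> borel_measurable borel" "lipschitz_wrt d L g" "L > 0"
    and int: "\<And>y. integrable (R y) g"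
    and contr: "contraction_coeff d R \<le> ennreal t" and t: "0 \<le> t"
  shows "lipschitz_wrt d (L * t) (kernel_operator R g)"
  unfolding lipschitz_wrt_def
proof (intro allI)
  fix y1 y2
  let ?D = "\<bar>kernel_operator R g y1 - kernel_operator R g y2\<bar>"
  show "?D \<le> L * t * d y1 y2"
  proof (cases "y1 = y2")
    case True
    moreover have "d y2 y2 = 0" using d unfolding distance_like_def by blast
    ultimately show ?thesis by simp
  next
    case False
    then have pos: "0 < d y1 y2" using d by (metis distance_like_def less_eq_real_def)
    \<comment> \<open>The easy half of Kantorovich duality: every coupling bounds the difference of
      the two integrals, so the infimum does as well, and no optimal coupling has to exist.\<close>
    have le: "ennreal (?D / L) \<le> (\<integral>\<^sup>+(x, y). ennreal (d x y) \<partial>\<xi>)" if "\<xi> \<in> couplings (R y1) (R y2)" for \<xi>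
    proof -
      have \<xi>: "sets \<xi> = sets (borel \<Otimes>\<^sub>M borel)" "distr \<xi> borel fst = R y1" "distr \<xi> borel snd = R y2"
        using that by (auto simp: couplings_def)
      have [measurable]: "fst \<in> \<xi> \<rightarrow>\<^sub>M borel" "snd \<in> \<xi> \<rightarrow>\<^sub>M borel"
        unfolding measurable_cong_sets[OF \<xi>(1) refl] by auto
      note g(1)[measurable]
      have i: "integrable \<xi> (\<lambda>z. g (fst z))" "integrable \<xi> (\<lambda>z. g (snd z))"
        using int[of y1] int[of y2] by (simp_all add: integrable_distr_eq flip: \<xi>(2,3))
      have "kernel_operator R g y1 - kernel_operator R g y2 = (\<integral>z. g (fst z) - g (snd z) \<partial>\<xi>)"
        using i by (simp add: kernel_operator_def integral_distr flip: \<xi>(2,3))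
      then have "ennreal ?D \<le> (\<integral>\<^sup>+z. ennreal (norm (g (fst z) - g (snd z))) \<partial>\<xi>)"
        using integral_norm_bound_ennreal[of \<xi> "\<lambda>z. g (fst z) - g (snd z)"] i by simp
      then have "ennreal (1 / L) * ennreal ?D \<le> ennreal (1 / L) * (\<integral>\<^sup>+z. ennreal (norm (g (fst z) - g (snd z))) \<partial>\<xi>)"
        by (intro mult_left_mono) auto
      also have "\<dots> = (\<integral>\<^sup>+z. ennreal (1 / L) * ennreal (norm (g (fst z) - g (snd z))) \<partial>\<xi>)"
        by (rule nn_integral_cmult[symmetric]) measurable
      also have "\<dots> \<le> (\<integral>\<^sup>+(x, y). ennreal (d x y) \<partial>\<xi>)"
      proof (rule nn_integral_mono)
        fix z :: "'y \<times> 'y"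
        have "\<bar>g (fst z) - g (snd z)\<bar> \<le> L * d (fst z) (snd z)"
          using g(2) by (simp add: lipschitz_wrt_def)
        then have "(1 / L) * \<bar>g (fst z) - g (snd z)\<bar> \<le> d (fst z) (snd z)"
          using g(3) by (simp add: field_simps)
        then show "ennreal (1 / L) * ennreal (norm (g (fst z) - g (snd z))) \<le> (case z of (x, y) \<Rightarrow> ennreal (d x y))"
          using g(3) by (simp add: case_prod_beta ennreal_mult'[symmetric] ennreal_leI)
      qed
      finally show ?thesis
        using g(3) by (simp add: ennreal_mult'[symmetric])
    qed
    have "ennreal (?D / L) \<le> wasserstein_like d (R y1) (R y2)"
      unfolding wasserstein_like_def by (rule INF_greatest) (rule le)
    moreover have "wasserstein_like d (R y1) (R y2) / ennreal (d y1 y2) \<le> ennreal t"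
    proof -
      have "wasserstein_like d (R y1) (R y2) / ennreal (d y1 y2) \<le> contraction_coeff d R"
        unfolding contraction_coeff_def using False
        by (intro SUP_upper2[where i="(y1, y2)"]) auto
      then show ?thesis using contr by simp
    qed
    ultimately have "ennreal (?D / L) / ennreal (d y1 y2) \<le> ennreal t"
      by (meson divide_right_mono_ennreal order_trans)
    then have "?D / L / d y1 y2 \<le> t"
      using pos g(3) t by (simp add: divide_ennreal)
    then show ?thesis using pos g(3) by (simp add: field_simps)
  qed
qed

section \<open>Iterates of a single kernel under a drift condition\<close>

locale drift_kernel =
  fixes Q :: "'y::second_countable_topology \<Rightarrow> 'y measure" and V :: "'y \<Rightarrow> real" and \<kappa> b :: real
  assumes kernel: "transition_kernel Q"
    and V_measurable[measurable]: "V \<in> borel_measurable borel" and V_ge_1: "\<And>y. 1 \<le> V y"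
    and \<kappa>: "0 < \<kappa>" "\<kappa> < 1" and b: "0 < b"
    and drift: "\<And>y. (\<integral>\<^sup>+y'. ennreal (V y') \<partial>Q y) \<le> ennreal (\<kappa> * V y + b)"
begin

text \<open>Finite \<open>V\<close>-weighted supremum norm. This class is stable under the kernel
  operator and integrable against every measure that integrates \<open>V\<close>, so Bochner
  integrals of its members never take the default value there.\<close>

definition dominated :: "('y \<Rightarrow> real) \<Rightarrow> bool" where
  "dominated g \<longleftrightarrow> g \<in> borel_measurable borel \<and> (\<exists>c. \<forall>y. \<bar>g y\<bar> \<le> c * V y)"

lemma Q_measurable[measurable]: "Q \<in> borel \<rightarrow>\<^sub>M subprob_algebra borel"
  using kernel by (auto simp: transition_kernel_def intro: measurable_prob_algebraD)

lemma integrable_if_dominated: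
  assumes g: "dominated g" and \<mu>: "sets \<mu> = sets borel" "(\<integral>\<^sup>+y. ennreal (V y) \<partial>\<mu>) < \<infinity>"
  shows "integrable \<mu> g"
proof -
  obtain c where c: "\<And>y. \<bar>g y\<bar> \<le> c * V y" and gm: "g \<in> borel_measurable borel"
    using g by (auto simp: dominated_def)
  have V: "integrable \<mu> V"
    using \<mu> V_ge_1 by (intro integrableI_nonneg) 
      (auto intro: order_trans[OF zero_le_one] simp: measurable_cong_sets[OF \<mu>(1) refl])
  then have "integrable \<mu> (\<lambda>y. c * V y)" by simp
  then show ?thesis
    by (rule Bochner_Integration.integrable_bound)
      (use gm c in \<open>auto simp: measurable_cong_sets[OF \<mu>(1) refl] intro: order_trans[OF _ abs_ge_self]\<close>)
qed

text \<open>Since \<open>V\<close> is at least 1, \<open>\<kappa> * V y + b\<close> is at most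
  \<open>(1 + b) * V y\<close>. The growth in \<open>n\<close> is harmless: the bound serves
  finiteness for each fixed \<open>n\<close> and a one-step estimate.\<close>

lemma nn_integral_kernel_pow_le: "(\<integral>\<^sup>+y'. ennreal (V y') \<partial>kernel_pow Q n y) \<le> ennreal ((1 + b) ^ n * V y)"
proof (induction n arbitrary: y)
  case 0
  then show ?case by (simp add: nn_integral_return)
next
  case (Suc n)
  have [measurable]: "kernel_pow Q n \<in> borel \<rightarrow>\<^sub>M subprob_algebra borel"
    using transition_kernel_pow[OF kernel] by (auto simp: transition_kernel_def intro: measurable_prob_algebraD)
  have m: "kernel_pow Q n \<in> Q y \<rightarrow>\<^sub>M subprob_algebra borel"
    unfolding measurable_cong_sets[OF transition_kernelD(2)[OF kernel] refl] by measurable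
  have "(\<integral>\<^sup>+y'. ennreal (V y') \<partial>kernel_pow Q (Suc n) y) =
      (\<integral>\<^sup>+z. \<integral>\<^sup>+y'. ennreal (V y') \<partial>kernel_pow Q n z \<partial>Q y)"
    by (simp add: nn_integral_bind[OF _ m])
  also have "\<dots> \<le> (\<integral>\<^sup>+z. ennreal ((1 + b) ^ n) * ennreal (V z) \<partial>Q y)"
    using Suc.IH b by (intro nn_integral_mono) (simp add: ennreal_mult')
  also have "\<dots> = ennreal ((1 + b) ^ n) * (\<integral>\<^sup>+z. ennreal (V z) \<partial>Q y)"
    by (rule nn_integral_cmult) (simp add: measurable_cong_sets[OF transition_kernelD(2)[OF kernel] refl])
  also have "\<dots> \<le> ennreal ((1 + b) ^ n) * ennreal ((1 + b) * V y)"
  proof (rule mult_left_mono)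
    have "\<kappa> * V y + b \<le> 1 * V y + b * V y"
      using V_ge_1[of y] \<kappa> b by (intro add_mono mult_right_mono) (auto simp: mult_le_cancel_left1)
    then show "(\<integral>\<^sup>+z. ennreal (V z) \<partial>Q y) \<le> ennreal ((1 + b) * V y)"
      using drift[of y] by (auto simp: algebra_simps intro: order_trans ennreal_leI)
  qed auto
  also have "\<dots> = ennreal ((1 + b) ^ Suc n * V y)"
    using b by (subst ennreal_mult'[symmetric]) (auto simp: mult_ac)
  finally show ?case .
qed

lemma integrable_kernel_pow:
  assumes "dominated g" shows "integrable (kernel_pow Q n y) g"
  using assms transition_kernelD(2)[OF transition_kernel_pow[OF kernel]]
  by (rule integrable_if_dominated) (use nn_integral_kernel_pow_le[of n y] in \<open>auto intro: le_less_trans\<close>)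

lemma integrable_kernel:
  assumes "dominated g" shows "integrable (Q y) g"
  using assms transition_kernelD(2)[OF kernel]
  by (rule integrable_if_dominated) (use drift[of y] in \<open>auto intro: le_less_trans\<close>)

lemma dominated_kernel_operator:
  assumes g: "dominated g" shows "dominated (kernel_operator Q g)"
proof -
  obtain c where c: "\<And>y. \<bar>g y\<bar> \<le> c * V y" and gm[measurable]: "g \<in> borel_measurable borel"
    using g by (auto simp: dominated_def)
  \<comment> \<open>Evaluation at one arbitrary point suffices: there \<open>c * V\<close> dominates
    an absolute value and \<open>V\<close> is positive.\<close>
  have c0: "0 \<le> c"
    using c[of undefined] V_ge_1[of undefined] by (smt (verit) mult_neg_pos)
  have "kernel_operator Q g \<in> borel_measurable borel"
    unfolding kernel_operator_def by (rule measurable_compose[OF Q_measurable integral_measurable_subprob_algebra[OF gm]])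
  moreover have "\<bar>kernel_operator Q g y\<bar> \<le> (c * (1 + b)) * V y" for y
  proof -
    have "ennreal \<bar>kernel_operator Q g y\<bar> \<le> (\<integral>\<^sup>+y'. ennreal (norm (g y')) \<partial>Q y)"
      unfolding kernel_operator_def
      using integral_norm_bound_ennreal[OF integrable_kernel[OF g]] by simp
    also have "\<dots> \<le> (\<integral>\<^sup>+y'. ennreal c * ennreal (V y') \<partial>Q y)"
      using c c0 by (intro nn_integral_mono) (simp add: ennreal_mult'[symmetric] ennreal_leI)
    also have "\<dots> = ennreal c * (\<integral>\<^sup>+y'. ennreal (V y') \<partial>Q y)"
      by (rule nn_integral_cmult) (simp add: measurable_cong_sets[OF transition_kernelD(2)[OF kernel] refl])
    also have "\<dots> \<le> ennreal c * ennreal ((1 + b) * V y)"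
      using nn_integral_kernel_pow_le[of 1 y]
      by (intro mult_left_mono) (simp_all add: bind_return''[OF transition_kernelD(2)[OF kernel]])
    also have "\<dots> = ennreal ((c * (1 + b)) * V y)"
      using c0 by (simp add: ennreal_mult'[symmetric] mult.assoc)
    finally show ?thesis
      using c0 b V_ge_1[of y] by (subst (asm) ennreal_le_iff) auto
  qed
  ultimately show ?thesis unfolding dominated_def by blast
qed

lemma dominated_iterate: "dominated g \<Longrightarrow> dominated ((kernel_operator Q ^^ n) g)"
  by (induction n) (auto intro: dominated_kernel_operator)

text \<open>Links the \<open>k0\<close>-step kernel, to which the contraction hypothesis refers,
  with iterates of the operator on functions. Since \<open>g\<close> may be unbounded, exchanging
  the integrals rests on its integrability under the multi-step kernel.\<close>

lemma kernel_operator_pow: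
  assumes g: "dominated g"
  shows "kernel_operator (kernel_pow Q n) g = (kernel_operator Q ^^ n) g"
proof (induction n)
  case 0
  have "g \<in> borel_measurable borel" using g by (simp add: dominated_def)
  then show ?case by (auto simp: kernel_operator_def integral_return)
next
  case (Suc n)
  have m: "kernel_pow Q n \<in> Q y \<rightarrow>\<^sub>M subprob_algebra borel" for y
    using transition_kernel_pow[OF kernel]
    unfolding measurable_cong_sets[OF transition_kernelD(2)[OF kernel] refl]
    by (auto simp: transition_kernel_def intro: measurable_prob_algebraD)
  have "kernel_operator (kernel_pow Q (Suc n)) g y = kernel_operator Q (kernel_operator (kernel_pow Q n) g) y" for y
    unfolding kernel_operator_def kernel_pow.simps
    by (rule integral_bind_integrable[OF m]) 
      (use g integrable_kernel_pow[OF g, of "Suc n" y] in \<open>auto simp: dominated_def\<close>)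
  then show ?case by (auto simp: Suc.IH)
qed

text \<open>Division of the number of steps by \<open>k0\<close>: the \<open>r\<close> leftover
  single steps cost a factor \<open>M\<close> each, the \<open>q\<close> blocks of length
  \<open>k0\<close> gain a factor \<open>\<tau>\<close> each.\<close>

lemma lipschitz_wrt_iterate:
  assumes d: "distance_like d" and "M > 0" "\<tau> > 0" "L > 0"
    and M: "contraction_coeff d Q \<le> ennreal M"
    and \<tau>: "contraction_coeff d (kernel_pow Q k0) \<le> ennreal \<tau>"
    and g: "dominated g" "lipschitz_wrt d L g"
  shows "lipschitz_wrt d (L * M ^ r * \<tau> ^ q) ((kernel_operator Q ^^ (q * k0 + r)) g)"
proof -
  have 1: "lipschitz_wrt d (L * M ^ r) ((kernel_operator Q ^^ r) g)"
  proof (induction r)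
    case 0
    then show ?case using g by simp
  next
    case (Suc r)
    have u: "dominated ((kernel_operator Q ^^ r) g)" using g(1) by (rule dominated_iterate)
    have "lipschitz_wrt d ((L * M ^ r) * M) (kernel_operator Q ((kernel_operator Q ^^ r) g))"
    proof (rule lipschitz_wrt_kernel_operator[OF d kernel _ Suc _ _ M])
      show "(kernel_operator Q ^^ r) g \<in> borel_measurable borel" using u by (simp add: dominated_def)
    qed (use integrable_kernel[OF u] assms(2,4) in auto)
    then show ?case by (simp add: mult_ac)
  qed
  show ?thesis
  proof (induction q)
    case 0
    then show ?case using 1 by simp
  next
    case (Suc q)
    let ?u = "(kernel_operator Q ^^ (q * k0 + r)) g"
    have u: "dominated ?u" using g(1) by (rule dominated_iterate)
    have "lipschitz_wrt d ((L * M ^ r * \<tau> ^ q) * \<tau>) (kernel_operator (kernel_pow Q k0) ?u)"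
    proof (rule lipschitz_wrt_kernel_operator[OF d transition_kernel_pow[OF kernel] _ Suc _ _ \<tau>])
      show "?u \<in> borel_measurable borel" using u by (simp add: dominated_def)
    qed (use integrable_kernel_pow[OF u] assms(2-4) in auto)
    also have "kernel_operator (kernel_pow Q k0) ?u = (kernel_operator Q ^^ (k0 + (q * k0 + r))) g"
      unfolding kernel_operator_pow[OF u] by (simp add: funpow_add)
    finally show ?case by (simp add: mult_ac add_ac)
  qed
qed

end

section \<open>The invariant distribution: moment of the drift function and decay of the
  iterates\<close>

locale invariant_drift_kernel = drift_kernel +
  fixes \<mu> :: "'a measure"
  assumes inv: "invariant_distribution Q \<mu>"
begin

lemma invariant_facts: "prob_space \<mu>" "sets \<mu> = sets borel" "space \<mu> = UNIV"
  using inv sets_eq_imp_space_eq[of \<mu> borel] by (auto simp: invariant_distribution_def)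

lemma Q_measurable_invariant: "Q \<in> \<mu> \<rightarrow>\<^sub>M subprob_algebra borel"
  unfolding measurable_cong_sets[OF invariant_facts(2) refl] by measurable

lemma bind_invariant: "\<mu> \<bind> Q = \<mu>"
proof (rule measure_eqI)
  have Qp: "Q \<in> \<mu> \<rightarrow>\<^sub>M prob_algebra borel"
    unfolding measurable_cong_sets[OF invariant_facts(2) refl] using kernel by (simp add: transition_kernel_def)
  show s: "sets (\<mu> \<bind> Q) = sets \<mu>"
    using invariant_facts by (subst sets_bind[where N=borel]) (auto simp: transition_kernelD[OF kernel])
  show "emeasure (\<mu> \<bind> Q) A = emeasure \<mu> A" if "A \<in> sets (\<mu> \<bind> Q)" for A
    using that inv unfolding s
    by (subst emeasure_bind[OF _ Q_measurable_invariant]) (auto simp: invariant_facts invariant_distribution_def)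
qed

text \<open>Truncating the drift inequality at level \<open>N\<close> gives
  \<open>min (V y) N + b \<ge> min (\<kappa> * V y + b) N + (1 - \<kappa>) * V y * 1{V y \<le> N}\<close>, and the two truncated
  terms cancel after integration because \<open>\<mu>\<close> is invariant.\<close>

lemma nn_integral_invariant_le: "(\<integral>\<^sup>+y. ennreal (V y) \<partial>\<mu>) \<le> ennreal (b / (1 - \<kappa>))"
proof -
  interpret prob_space \<mu> by (rule invariant_facts)
  have sets[measurable_cong]: "sets \<mu> = sets borel" by (rule invariant_facts)
  have V0: "0 \<le> V y" for y using V_ge_1[of y] by simp
  have N: "(\<integral>\<^sup>+y. ennreal (V y) * indicator {y. V y \<le> real N} y \<partial>\<mu>) \<le> ennreal (b / (1 - \<kappa>))" for N
  proof -
    let ?T = "\<lambda>y. ennreal (min (V y) (real N))"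
    let ?S = "\<lambda>y. ennreal (min (\<kappa> * V y + b) (real N))"
    let ?J = "\<lambda>y. ennreal (V y) * indicator {y. V y \<le> real N} y"
    have TS: "(\<integral>\<^sup>+y. ?T y \<partial>\<mu>) \<le> (\<integral>\<^sup>+y. ?S y \<partial>\<mu>)"
    proof -
      have "(\<integral>\<^sup>+y. ?T y \<partial>\<mu>) = (\<integral>\<^sup>+y. ?T y \<partial>(\<mu> \<bind> Q))" by (simp add: bind_invariant)
      also have "\<dots> = (\<integral>\<^sup>+y. (\<integral>\<^sup>+y'. ?T y' \<partial>Q y) \<partial>\<mu>)"
        by (rule nn_integral_bind[OF _ Q_measurable_invariant]) measurable
      also have "\<dots> \<le> (\<integral>\<^sup>+y. ?S y \<partial>\<mu>)"
      proof (rule nn_integral_mono)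
        fix y
        interpret q: prob_space "Q y" by (rule transition_kernelD[OF kernel])
        have "(\<integral>\<^sup>+y'. ?T y' \<partial>Q y) \<le> (\<integral>\<^sup>+y'. ennreal (V y') \<partial>Q y)"
          by (intro nn_integral_mono ennreal_leI) auto
        moreover have "(\<integral>\<^sup>+y'. ?T y' \<partial>Q y) \<le> (\<integral>\<^sup>+y'. ennreal (real N) \<partial>Q y)"
          by (intro nn_integral_mono ennreal_leI) auto
        ultimately show "(\<integral>\<^sup>+y'. ?T y' \<partial>Q y) \<le> ?S y"
          using drift[of y] q.emeasure_space_1 by (auto simp: min_def)
      qed
      finally show ?thesis .
    qed
    \<comment> \<open>Cancelling \<open>?S\<close> from both sides in \<open>ennreal\<close> is
      legitimate because its integral is finite; this is what the truncation is for, as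
      \<open>V\<close> is not yet known to be integrable.\<close>
    have fin: "(\<integral>\<^sup>+y. ?S y \<partial>\<mu>) \<noteq> \<infinity>"
    proof -
      have "(\<integral>\<^sup>+y. ?S y \<partial>\<mu>) \<le> (\<integral>\<^sup>+y. ennreal (real N) \<partial>\<mu>)"
        by (intro nn_integral_mono ennreal_leI) auto
      then show ?thesis by (auto simp: emeasure_space_1 top_unique)
    qed
    have "(\<integral>\<^sup>+y. ?S y \<partial>\<mu>) + ennreal (1 - \<kappa>) * (\<integral>\<^sup>+y. ?J y \<partial>\<mu>)
        = (\<integral>\<^sup>+y. ?S y + ennreal (1 - \<kappa>) * ?J y \<partial>\<mu>)"
      by (subst nn_integral_add) (auto simp: nn_integral_cmult)
    also have "\<dots> \<le> (\<integral>\<^sup>+y. ?T y + ennreal b \<partial>\<mu>)"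
    proof (rule nn_integral_mono)
      fix y
      have "min (\<kappa> * V y + b) (real N) + (1 - \<kappa>) * (V y * indicator {y. V y \<le> real N} y) \<le> min (V y) (real N) + b"
        using b V0[of y] by (auto simp: min_def algebra_simps indicator_def)
      then have "ennreal (min (\<kappa> * V y + b) (real N) + (1 - \<kappa>) * (V y * indicator {y. V y \<le> real N} y))
          \<le> ennreal (min (V y) (real N) + b)" by (rule ennreal_leI)
      also have "\<dots> = ?T y + ennreal b" using b V0[of y] by (intro ennreal_plus) auto
      also have "ennreal (min (\<kappa> * V y + b) (real N) + (1 - \<kappa>) * (V y * indicator {y. V y \<le> real N} y))
          = ?S y + ennreal (1 - \<kappa>) * ?J y"
        using \<kappa> b V0[of y] by (subst ennreal_plus) (auto simp: ennreal_mult' indicator_def)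
      finally show "?S y + ennreal (1 - \<kappa>) * ?J y \<le> ?T y + ennreal b" .
    qed
    also have "\<dots> = (\<integral>\<^sup>+y. ?T y \<partial>\<mu>) + ennreal b"
      by (subst nn_integral_add) (auto simp: emeasure_space_1)
    also have "\<dots> \<le> (\<integral>\<^sup>+y. ?S y \<partial>\<mu>) + ennreal b" by (intro add_right_mono TS)
    finally have "ennreal (1 - \<kappa>) * (\<integral>\<^sup>+y. ?J y \<partial>\<mu>) \<le> ennreal b"
      using fin by (simp add: ennreal_add_left_cancel_le)
    then have "ennreal (1 / (1 - \<kappa>)) * (ennreal (1 - \<kappa>) * (\<integral>\<^sup>+y. ?J y \<partial>\<mu>)) \<le> ennreal (1 / (1 - \<kappa>)) * ennreal b"
      by (intro mult_left_mono) auto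
    also have "ennreal (1 / (1 - \<kappa>)) * (ennreal (1 - \<kappa>) * (\<integral>\<^sup>+y. ?J y \<partial>\<mu>)) = (\<integral>\<^sup>+y. ?J y \<partial>\<mu>)"
      using \<kappa> by (simp add: mult.assoc[symmetric] ennreal_mult'[symmetric])
    also have "ennreal (1 / (1 - \<kappa>)) * ennreal b = ennreal (b / (1 - \<kappa>))"
      using \<kappa> by (simp add: ennreal_mult'[symmetric])
    finally show ?thesis .
  qed
  have "(\<integral>\<^sup>+y. ennreal (V y) \<partial>\<mu>) = (\<integral>\<^sup>+y. (SUP N. ennreal (V y) * indicator {y. V y \<le> real N} y) \<partial>\<mu>)"
  proof (rule nn_integral_cong)
    fix y
    obtain N where "V y \<le> real N" using real_arch_simple by blast
    then show "ennreal (V y) = (SUP N. ennreal (V y) * indicator {y. V y \<le> real N} y)"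
      by (intro antisym SUP_least) (auto intro!: SUP_upper2[where i=N] simp: indicator_def)
  qed
  also have "\<dots> = (SUP N. \<integral>\<^sup>+y. ennreal (V y) * indicator {y. V y \<le> real N} y \<partial>\<mu>)"
    by (rule nn_integral_monotone_convergence_SUP)
       (auto simp: incseq_def le_fun_def indicator_def intro: order_trans)
  also have "\<dots> \<le> ennreal (b / (1 - \<kappa>))" by (rule SUP_least) (rule N)
  finally show ?thesis .
qed

lemma integrable_invariant: "dominated g \<Longrightarrow> integrable \<mu> g"
  using nn_integral_invariant_le by (intro integrable_if_dominated) (auto simp: invariant_facts intro: le_less_trans)

lemma integral_iterate_invariant:
  assumes g: "dominated g" shows "(\<integral>y. (kernel_operator Q ^^ n) g y \<partial>\<mu>) = (\<integral>y. g y \<partial>\<mu>)"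
proof (induction n)
  case (Suc n)
  have u: "dominated ((kernel_operator Q ^^ n) g)" using g by (rule dominated_iterate)
  have "(\<integral>y. (kernel_operator Q ^^ n) g y \<partial>(\<mu> \<bind> Q)) = (\<integral>y. (kernel_operator Q ^^ Suc n) g y \<partial>\<mu>)"
    using integral_bind_integrable[OF Q_measurable_invariant, of "(kernel_operator Q ^^ n) g"]
      u integrable_invariant[OF u] by (simp add: bind_invariant dominated_def kernel_operator_def)
  then show ?case using Suc by (simp add: bind_invariant)
qed simp

text \<open>An iterate \<open>u\<close> of \<open>g\<close> has mean 0 under \<open>\<mu>\<close>,
  so \<open>u y\<close> is the \<open>\<mu>\<close>-average of \<open>u y - u y'\<close>. The
  Lipschitz bound and \<open>dU\<close> control this by \<open>U y\<close> plus the mean of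
  \<open>U\<close>, which is at most \<open>b / (1 - \<kappa>)\<close>; as \<open>U\<close> is at
  least 1, a multiple of \<open>U y\<close> remains. The weight stays \<open>U\<close>, not
  \<open>V\<close>.\<close>

lemma iterate_bound:
  assumes d: "distance_like d" and "M > 0" "\<tau> > 0" "L > 0" "K > 0"
    and M: "contraction_coeff d Q \<le> ennreal M"
    and \<tau>: "contraction_coeff d (kernel_pow Q k0) \<le> ennreal \<tau>"
    and g: "dominated g" "lipschitz_wrt d L g" "(\<integral>y. g y \<partial>\<mu>) = 0"
    and U: "U \<in> borel_measurable borel" "\<And>y. 1 \<le> U y" "\<And>y. U y \<le> V y"
    and dU: "\<And>y1 y2. d y1 y2 \<le> K * (U y1 + U y2)"
  shows "\<bar>(kernel_operator Q ^^ k) g y\<bar>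
    \<le> L * M ^ (k mod k0) * \<tau> ^ (k div k0) * (K * (1 + b / (1 - \<kappa>))) * U y"
proof -
  interpret prob_space \<mu> by (rule invariant_facts)
  let ?u = "(kernel_operator Q ^^ k) g"
  define a where "a = L * M ^ (k mod k0) * \<tau> ^ (k div k0)"
  have a: "a \<ge> 0" using assms by (simp add: a_def)
  have lip: "lipschitz_wrt d a ?u"
    using lipschitz_wrt_iterate[OF d assms(2-4) M \<tau> g(1,2), of "k mod k0" "k div k0"]
    by (simp add: a_def)
  have u: "dominated ?u" using g(1) by (rule dominated_iterate)
  have Ud: "dominated U"
    unfolding dominated_def using U by (intro conjI exI[of _ 1]) (auto intro: order_trans[OF abs_leI] simp: abs_of_nonneg order_trans[OF zero_le_one])
  have Ui: "integrable \<mu> U" and ui: "integrable \<mu> ?u" using Ud u by (auto intro: integrable_invariant)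
  have Vd: "dominated V"
    unfolding dominated_def using V_ge_1 by (intro conjI exI[of _ 1]) (auto simp: abs_of_nonneg order_trans[OF zero_le_one])
  have UB: "(\<integral>y. U y \<partial>\<mu>) \<le> b / (1 - \<kappa>)"
  proof -
    have "(\<integral>y. U y \<partial>\<mu>) \<le> (\<integral>y. V y \<partial>\<mu>)"
      using U integrable_invariant[OF Vd] Ui by (intro integral_mono) auto
    also have "ennreal (\<integral>y. V y \<partial>\<mu>) = (\<integral>\<^sup>+y. ennreal (V y) \<partial>\<mu>)"
      using integrable_invariant[OF Vd] V_ge_1 by (intro nn_integral_eq_integral[symmetric]) (auto intro: order_trans[OF zero_le_one])
    then have "(\<integral>y. V y \<partial>\<mu>) \<le> b / (1 - \<kappa>)"
      using nn_integral_invariant_le b \<kappa> by (metis divide_nonneg_pos diff_gt_0_iff_gt ennreal_le_iff less_imp_le)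
    finally show ?thesis .
  qed
  have "?u y = (\<integral>y'. ?u y - ?u y' \<partial>\<mu>)"
    using ui integral_iterate_invariant[OF g(1), of k] g(3) by (simp add: prob_space)
  also have "\<bar>\<dots>\<bar> \<le> (\<integral>y'. \<bar>?u y - ?u y'\<bar> \<partial>\<mu>)"
    by (rule integral_abs_bound)
  also have "\<dots> \<le> (\<integral>y'. a * (K * (U y + U y')) \<partial>\<mu>)"
  proof (rule integral_mono)
    show "integrable \<mu> (\<lambda>y'. \<bar>?u y - ?u y'\<bar>)" using ui by simp
    show "integrable \<mu> (\<lambda>y'. a * (K * (U y + U y')))" using Ui by simp
    show "\<bar>?u y - ?u y'\<bar> \<le> a * (K * (U y + U y'))" for y'
      using lip dU[of y y'] a unfolding lipschitz_wrt_def by (meson mult_left_mono order_trans)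
  qed
  also have "\<dots> = a * (K * (U y + (\<integral>y'. U y' \<partial>\<mu>)))"
    using Ui by (simp add: prob_space)
  also have "\<dots> \<le> a * (K * ((1 + b / (1 - \<kappa>)) * U y))"
  proof -
    have "(\<integral>y'. U y' \<partial>\<mu>) \<le> b / (1 - \<kappa>) * 1" using UB by simp
    also have "\<dots> \<le> b / (1 - \<kappa>) * U y" using U b \<kappa> by (intro mult_left_mono) auto
    finally show ?thesis
      using a assms(5) by (intro mult_left_mono) (auto simp: algebra_simps)
  qed
  finally show ?thesis by (simp add: a_def mult_ac)
qed

end

section \<open>The Poisson equation\<close>

context drift_kernel
begin

text \<open>Applying \<open>Q\<close> term by term shifts the series and so removes its first term
  \<open>g\<close>. The exchange of sum and integral is justified by the majorant
  \<open>a k * V\<close>; the sharper weight \<open>U\<close> is kept for the bound on the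
  solution.\<close>

lemma poisson_solution:
  assumes g: "dominated g"
    and U: "\<And>y. 0 \<le> U y" "\<And>y. U y \<le> V y"
    and a: "summable a" "\<And>k. 0 \<le> a k" and le: "\<And>k y. \<bar>(kernel_operator Q ^^ k) g y\<bar> \<le> a k * U y"
  shows "\<bar>poisson_solution Q g y\<bar> \<le> suminf a * U y"
    and "dominated (poisson_solution Q g)"
    and "kernel_operator Q (poisson_solution Q g) y = poisson_solution Q g y - g y"
proof -
  let ?u = "\<lambda>k. (kernel_operator Q ^^ k) g"
  have s: "summable (\<lambda>k. \<bar>?u k y\<bar>)" for y
    by (rule summable_comparison_test'[OF summable_mult2[OF a(1), of "U y"]]) (use le in auto)
  have bound: "\<bar>poisson_solution Q g y\<bar> \<le> suminf a * U y" for y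
  proof -
    have "\<bar>poisson_solution Q g y\<bar> \<le> (\<Sum>k. \<bar>?u k y\<bar>)"
      unfolding poisson_solution_def by (rule summable_rabs[OF s])
    also have "\<dots> \<le> (\<Sum>k. a k * U y)"
      by (rule suminf_le[OF le s summable_mult2[OF a(1)]])
    also have "\<dots> = suminf a * U y" using suminf_mult2[OF a(1)] by simp
    finally show ?thesis .
  qed
  then show "\<bar>poisson_solution Q g y\<bar> \<le> suminf a * U y" .
  have m: "?u k \<in> borel_measurable borel" for k
    using dominated_iterate[OF g] by (simp add: dominated_def)
  have "\<bar>poisson_solution Q g y\<bar> \<le> \<bar>suminf a\<bar> * V y" for y
    using bound[of y] U[of y] by (meson abs_ge_self abs_ge_zero mult_mono order_trans)
  then show "dominated (poisson_solution Q g)"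
    unfolding dominated_def poisson_solution_def using m by (auto intro!: borel_measurable_suminf)
  have "kernel_operator Q (poisson_solution Q g) y = (\<Sum>k. \<integral>y'. ?u k y' \<partial>Q y)"
    unfolding kernel_operator_def[of Q "poisson_solution Q g"] poisson_solution_def
  proof (rule integral_suminf)
    show int: "integrable (Q y) (?u k)" for k
      using dominated_iterate[OF g] by (rule integrable_kernel)
    show "AE y' in Q y. summable (\<lambda>k. norm (?u k y'))" using s by simp
    have V: "integrable (Q y) V"
      by (rule integrable_kernel) (use V_ge_1 in \<open>auto simp: dominated_def abs_of_nonneg order_trans[OF zero_le_one] intro!: exI[of _ 1]\<close>)
    show "summable (\<lambda>k. \<integral>y'. norm (?u k y') \<partial>Q y)"
    proof (rule summable_comparison_test')
      show "summable (\<lambda>k. \<bar>a k\<bar> * (\<integral>y'. V y' \<partial>Q y))"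
        using a by (intro summable_mult2) simp
      show "norm (\<integral>y'. norm (?u k y') \<partial>Q y) \<le> \<bar>a k\<bar> * (\<integral>y'. V y' \<partial>Q y)" if "k \<ge> 0" for k
      proof -
        have "(\<integral>y'. norm (?u k y') \<partial>Q y) \<le> (\<integral>y'. \<bar>a k\<bar> * V y' \<partial>Q y)"
        proof (rule integral_mono)
          fix y'
          have "a k * U y' \<le> a k * V y'" using a(2) U(2) by (rule mult_left_mono[rotated])
          then show "norm (?u k y') \<le> \<bar>a k\<bar> * V y'"
            using le[of k y'] a(2)[of k] by simp
        qed (use int V in auto)
        then show ?thesis by simp
      qed
    qed
  qed
  also have "\<dots> = (\<Sum>k. ?u (Suc k) y)" by (simp add: kernel_operator_def)
  also have "\<dots> = poisson_solution Q g y - g y"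
    unfolding poisson_solution_def using suminf_split_head[OF summable_rabs_cancel[OF s, of y]] by simp
  finally show "kernel_operator Q (poisson_solution Q g) y = poisson_solution Q g y - g y" .
qed

end

text \<open>Comparison with a geometric series of ratio \<open>\<tau> powr (1 / k0)\<close>:
  rounding \<open>k\<close> down to a multiple of \<open>k0\<close> loses at most the factor
  \<open>1 / \<rho> ^ k0\<close>, and the power of \<open>M\<close> is at most
  \<open>M ^ k0\<close>.\<close>

lemma summable_power_mod_div:
  fixes M \<tau> :: real
  assumes "1 \<le> M" "0 < \<tau>" "\<tau> < 1" "1 \<le> k0"
  shows "summable (\<lambda>k. M ^ (k mod k0) * \<tau> ^ (k div k0))"
proof -
  define \<rho> where "\<rho> = \<tau> powr (1 / real k0)"
  have \<rho>: "0 < \<rho>" "\<rho> < 1"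
    using assms powr_less_mono2[of "1 / real k0" \<tau> 1] by (auto simp: \<rho>_def)
  have \<rho>k: "\<rho> ^ k0 = \<tau>"
    using assms by (simp add: \<rho>_def powr_realpow[symmetric] powr_powr)
  show ?thesis
  proof (rule summable_comparison_test')
    show "summable (\<lambda>k. M ^ k0 / \<rho> ^ k0 * \<rho> ^ k)"
      using \<rho> by (intro summable_mult summable_geometric) auto
    fix k :: nat
    have "\<tau> ^ (k div k0) * \<rho> ^ k0 = \<rho> ^ (k0 * (k div k0) + k0)"
      by (simp add: \<rho>k power_add power_mult)
    also have "\<dots> \<le> \<rho> ^ k"
    proof (rule power_decreasing)
      have "k mod k0 \<le> k0" using assms by (simp add: less_imp_le)
      then show "k \<le> k0 * (k div k0) + k0" by (metis add_le_cancel_left mult_div_mod_eq)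
    qed (use \<rho> in auto)
    finally have 1: "\<tau> ^ (k div k0) \<le> \<rho> ^ k / \<rho> ^ k0" using \<rho> by (simp add: field_simps)
    have 2: "M ^ (k mod k0) \<le> M ^ k0" using assms by (intro power_increasing) (auto simp: less_imp_le)
    have "M ^ (k mod k0) * \<tau> ^ (k div k0) \<le> M ^ k0 * (\<rho> ^ k / \<rho> ^ k0)"
      using assms by (intro mult_mono 1 2) auto
    then show "norm (M ^ (k mod k0) * \<tau> ^ (k div k0)) \<le> M ^ k0 / \<rho> ^ k0 * \<rho> ^ k"
      using assms by (simp add: abs_mult)
  qed
qed


section \<open>The Markov property of the chain\<close>

text \<open>Pushing \<open>L x\<close> forward along \<open>Pair x\<close> turns an integrand that
  varies with \<open>x\<close> into one fixed function on the product.\<close>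

lemma integral_measurable_kernel:
  fixes f :: "'a \<Rightarrow> 'b \<Rightarrow> real"
  assumes f[measurable]: "(\<lambda>(x, y). f x y) \<in> borel_measurable (M \<Otimes>\<^sub>M N)"
    and L[measurable]: "L \<in> M \<rightarrow>\<^sub>M subprob_algebra N"
  shows "(\<lambda>x. \<integral>y. f x y \<partial>L x) \<in> borel_measurable M"
proof -
  have "(\<lambda>x. distr (L x) (M \<Otimes>\<^sub>M N) (Pair x)) \<in> M \<rightarrow>\<^sub>M subprob_algebra (M \<Otimes>\<^sub>M N)"
    by (rule measurable_distr2[where M=N]) (auto simp: L)
  then have "(\<lambda>x. \<integral>z. (\<lambda>(x, y). f x y) z \<partial>distr (L x) (M \<Otimes>\<^sub>M N) (Pair x)) \<in> borel_measurable M"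
    by (rule measurable_compose[OF _ integral_measurable_subprob_algebra[OF f]])
  also have "?this \<longleftrightarrow> (\<lambda>x. \<integral>y. f x y \<partial>L x) \<in> borel_measurable M"
  proof (rule measurable_cong)
    fix x assume x: "x \<in> space M"
    have "Pair x \<in> L x \<rightarrow>\<^sub>M M \<Otimes>\<^sub>M N"
      using x unfolding measurable_cong_sets[OF sets_kernel[OF L x] refl] by (intro measurable_Pair1') simp
    from integral_distr[OF this f]
    show "(\<integral>z. (\<lambda>(x, y). f x y) z \<partial>distr (L x) (M \<Otimes>\<^sub>M N) (Pair x)) = (\<integral>y. f x y \<partial>L x)"
      by simp
  qed
  finally show ?thesis .
qed

text \<open>The Markov property for integrands that see both the past and the next state: in the
  inner integral everything that depends on \<open>\<omega>\<close> is frozen. This covers an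
  earlier increment as a factor and the random parameter in one statement.\<close>

lemma integral_kernel_disintegration:
  fixes H :: "'a \<Rightarrow> 'b \<Rightarrow> real"
  assumes "prob_space M" and sub: "subalgebra M F"
    and X[measurable]: "X \<in> M \<rightarrow>\<^sub>M N" and Q: "Q \<in> F \<rightarrow>\<^sub>M prob_algebra N"
    and eq: "\<forall>A\<in>sets F. \<forall>B\<in>sets N.
      emeasure M (A \<inter> (X -` B \<inter> space M)) = (\<integral>\<^sup>+\<omega>. emeasure (Q \<omega>) B * indicator A \<omega> \<partial>M)"
    and H: "(\<lambda>(\<omega>, y). H \<omega> y) \<in> borel_measurable (F \<Otimes>\<^sub>M N)"
    and int: "integrable M (\<lambda>\<omega>. H \<omega> (X \<omega>))"
  shows "(\<integral>\<omega>. H \<omega> (X \<omega>) \<partial>M) = (\<integral>\<omega>. (\<integral>y. H \<omega> y \<partial>Q \<omega>) \<partial>M)"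
proof -
  interpret prob_space M by fact
  have sp: "space M = space F" using sub by (simp add: subalgebra_def)
  have id: "(\<lambda>x. x) \<in> M \<rightarrow>\<^sub>M F"
    using sub by (auto simp: subalgebra_def measurable_def)
  have XM: "(\<lambda>\<omega>. (\<omega>, X \<omega>)) \<in> M \<rightarrow>\<^sub>M F \<Otimes>\<^sub>M N" using id by measurable
  note bind = distr_pair_eq_bind_kernel[OF assms(1) sub X Q eq]
  let ?K = "\<lambda>\<omega>. distr (Q \<omega>) (F \<Otimes>\<^sub>M N) (Pair \<omega>)"
  have K: "?K \<in> M \<rightarrow>\<^sub>M subprob_algebra (F \<Otimes>\<^sub>M N)"
    using bind(1) by (rule measurable_prob_algebraD)
  have "(\<integral>\<omega>. H \<omega> (X \<omega>) \<partial>M) = (\<integral>z. (\<lambda>(\<omega>, y). H \<omega> y) z \<partial>distr M (F \<Otimes>\<^sub>M N) (\<lambda>\<omega>. (\<omega>, X \<omega>)))"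
    by (simp add: integral_distr[OF XM H])
  also have "\<dots> = (\<integral>\<omega>. (\<integral>z. (\<lambda>(\<omega>, y). H \<omega> y) z \<partial>?K \<omega>) \<partial>M)"
    unfolding bind(2)
  proof (rule integral_bind_integrable[OF K H])
    show "integrable (M \<bind> ?K) (\<lambda>(\<omega>, y). H \<omega> y)"
      using int unfolding bind(2)[symmetric] by (subst integrable_distr_eq[OF XM H]) simp
  qed
  also have "\<dots> = (\<integral>\<omega>. (\<integral>y. H \<omega> y \<partial>Q \<omega>) \<partial>M)"
  proof (rule Bochner_Integration.integral_cong[OF refl])
    fix \<omega> assume "\<omega> \<in> space M"
    then have w: "\<omega> \<in> space F" using sp by simp
    have s: "sets (Q \<omega>) = sets N" using measurable_space[OF Q w] by (simp add: space_prob_algebra)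
    have "Pair \<omega> \<in> Q \<omega> \<rightarrow>\<^sub>M F \<Otimes>\<^sub>M N"
      using w unfolding measurable_cong_sets[OF s refl] by (intro measurable_Pair1') simp
    from integral_distr[OF this H]
    show "(\<integral>z. (\<lambda>(\<omega>, y). H \<omega> y) z \<partial>?K \<omega>) = (\<integral>y. H \<omega> y \<partial>Q \<omega>)"
      by simp
  qed
  finally show ?thesis .
qed

text \<open>Taking \<open>A\<close> to be the whole space identifies the law of \<open>X\<close>.
  This version applies before any integrability is known, and so carries the drift inequality over
  to moments of the chain.\<close>

lemma nn_integral_kernel_disintegration:
  assumes "prob_space M" and sub: "subalgebra M F"
    and X[measurable]: "X \<in> M \<rightarrow>\<^sub>M N" and Q: "Q \<in> F \<rightarrow>\<^sub>M prob_algebra N"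
    and eq: "\<forall>A\<in>sets F. \<forall>B\<in>sets N.
      emeasure M (A \<inter> (X -` B \<inter> space M)) = (\<integral>\<^sup>+\<omega>. emeasure (Q \<omega>) B * indicator A \<omega> \<partial>M)"
    and h[measurable]: "h \<in> borel_measurable N"
  shows "(\<integral>\<^sup>+\<omega>. h (X \<omega>) \<partial>M) = (\<integral>\<^sup>+\<omega>. (\<integral>\<^sup>+y. h y \<partial>Q \<omega>) \<partial>M)"
proof -
  interpret prob_space M by fact
  have sp: "space M = space F" using sub by (simp add: subalgebra_def)
  have id: "(\<lambda>x. x) \<in> M \<rightarrow>\<^sub>M F"
    using sub by (auto simp: subalgebra_def measurable_def)
  have QM: "Q \<in> M \<rightarrow>\<^sub>M subprob_algebra N"
    using measurable_compose[OF id Q] by (auto intro: measurable_prob_algebraD)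
  have "distr M N X = M \<bind> Q"
  proof (rule measure_eqI)
    have Ms: "M \<in> space (prob_algebra M)" by (simp add: space_prob_algebra prob_space_axioms)
    have QP: "Q \<in> M \<rightarrow>\<^sub>M prob_algebra N" using measurable_compose[OF id Q] by simp
    show "sets (distr M N X) = sets (M \<bind> Q)" by (simp add: sets_bind'[OF Ms QP])
    show "emeasure (distr M N X) B = emeasure (M \<bind> Q) B" if "B \<in> sets (distr M N X)" for B
    proof -
      have B: "B \<in> sets N" using that by simp
      have "emeasure (distr M N X) B = emeasure M (space F \<inter> (X -` B \<inter> space M))"
        using B by (simp add: emeasure_distr sp Int_absorb1)
      also have "\<dots> = (\<integral>\<^sup>+\<omega>. emeasure (Q \<omega>) B * indicator (space F) \<omega> \<partial>M)"
        using B eq by auto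
      also have "\<dots> = (\<integral>\<^sup>+\<omega>. emeasure (Q \<omega>) B \<partial>M)"
        by (intro nn_integral_cong) (simp add: sp)
      also have "\<dots> = emeasure (M \<bind> Q) B"
        by (rule emeasure_bind_prob_algebra[OF Ms QP B, symmetric])
      finally show ?thesis .
    qed
  qed
  moreover have "(\<integral>\<^sup>+\<omega>. h (X \<omega>) \<partial>M) = (\<integral>\<^sup>+y. h y \<partial>distr M N X)"
    by (rule nn_integral_distr[symmetric]) auto
  ultimately show ?thesis
    using nn_integral_bind[OF h QM] by simp
qed

section \<open>History, transition law and joint measurability for the chain\<close>

context air_mcmc_chain
begin

abbreviation "\<F> \<equiv> history \<Omega> I Y \<Gamma>"

lemma sets_history: "sets (\<F> n) = sigma_sets (space \<Omega>)
     ({Y i -` B \<inter> space \<Omega> | i B. i \<le> n \<and> B \<in> sets borel} \<union>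
      {\<Gamma> i -` B \<inter> space \<Omega> | i B. i \<le> n \<and> B \<in> sets I})"
  unfolding history_def by (rule sets_measure_of) auto

lemma space_history: "space (\<F> n) = space \<Omega>"
  unfolding history_def by (rule space_measure_of) auto

lemma subalgebra_history: "subalgebra \<Omega> (\<F> n)"
  unfolding subalgebra_def space_history sets_history
  using measurable_sets[OF measurable_Y] measurable_sets[OF measurable_\<Gamma>]
  by (auto intro!: sets.sigma_sets_subset)

lemma measurable_history:
  assumes "i \<le> n"
  shows "Y i \<in> \<F> n \<rightarrow>\<^sub>M borel" "\<Gamma> i \<in> \<F> n \<rightarrow>\<^sub>M I"
proof -
  show "Y i \<in> \<F> n \<rightarrow>\<^sub>M borel"
    using assms by (intro measurableI) (auto simp: space_history sets_history intro!: sigma_sets.Basic)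
  show "\<Gamma> i \<in> \<F> n \<rightarrow>\<^sub>M I"
    using assms measurable_space[OF measurable_\<Gamma>]
    by (intro measurableI) (auto simp: space_history sets_history intro!: sigma_sets.Basic)
qed

lemma kernel_family_measurable: "(\<lambda>(y, \<gamma>). P \<gamma> y) \<in> borel \<Otimes>\<^sub>M I \<rightarrow>\<^sub>M prob_algebra borel"
proof (rule measurable_prob_algebraI)
  show "prob_space (case z of (y, \<gamma>) \<Rightarrow> P \<gamma> y)" if "z \<in> space (borel \<Otimes>\<^sub>M I)" for z :: "('x \<times> 'p) \<times> 'i"
    using that transition_kernelD[OF kernel] by (auto simp: space_pair_measure)
  show "(\<lambda>(y, \<gamma>). P \<gamma> y) \<in> borel \<Otimes>\<^sub>M I \<rightarrow>\<^sub>M subprob_algebra borel"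
  proof (rule measurable_subprob_algebra)
    fix z :: "('x \<times> 'p) \<times> 'i" assume z: "z \<in> space (borel \<Otimes>\<^sub>M I)"
    then show "subprob_space (case z of (y, \<gamma>) \<Rightarrow> P \<gamma> y)"
      using transition_kernelD[OF kernel] by (auto simp: space_pair_measure intro!: prob_space_imp_subprob_space)
    show "sets (case z of (y, \<gamma>) \<Rightarrow> P \<gamma> y) = sets borel"
      using z transition_kernelD[OF kernel] by (auto simp: space_pair_measure)
  next
    fix A :: "('x \<times> 'p) set" assume "A \<in> sets borel"
    then show "(\<lambda>z. emeasure (case z of (y, \<gamma>) \<Rightarrow> P \<gamma> y) A) \<in> borel_measurable (borel \<Otimes>\<^sub>M I)"
      using kernel_jointly_measurable[of A] by (simp add: case_prod_beta)
  qed
qed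

lemma current_kernel_measurable: "(\<lambda>\<omega>. P (\<Gamma> n \<omega>) (Y n \<omega>)) \<in> \<F> n \<rightarrow>\<^sub>M prob_algebra borel"
proof -
  have "(\<lambda>\<omega>. (Y n \<omega>, \<Gamma> n \<omega>)) \<in> \<F> n \<rightarrow>\<^sub>M borel \<Otimes>\<^sub>M I"
    using measurable_history[of n n] by simp
  from measurable_compose[OF this kernel_family_measurable] show ?thesis by simp
qed

lemma current_kernel: "\<omega> \<in> space \<Omega> \<Longrightarrow> transition_kernel (P (\<Gamma> n \<omega>))"
  using measurable_space[OF measurable_\<Gamma>] by (rule kernel)

text \<open>Integrating the conditional expectation over an event \<open>A\<close> of the past
  absorbs the null set that depends on \<open>B\<close>, leaving an identity valid for all
  \<open>A\<close> and \<open>B\<close> at once.\<close>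

lemma transition_emeasure:
  "\<forall>A\<in>sets (\<F> n). \<forall>B\<in>sets borel. emeasure \<Omega> (A \<inter> (Y (Suc n) -` B \<inter> space \<Omega>))
    = (\<integral>\<^sup>+\<omega>. emeasure (P (\<Gamma> n \<omega>) (Y n \<omega>)) B * indicator A \<omega> \<partial>\<Omega>)"
proof (intro ballI)
  fix A and B :: "('x \<times> 'p) set"
  assume A: "A \<in> sets (\<F> n)" and B: "B \<in> sets borel"
  interpret \<Omega>: prob_space \<Omega> by (rule prob_space_\<Omega>)
  interpret finite_measure_subalgebra \<Omega> "\<F> n"
    by unfold_locales (rule subalgebra_history)
  have A'[measurable]: "A \<in> sets \<Omega>" using A subalgebra_history[of n] by (auto simp: subalgebra_def)
  have YB[measurable]: "Y (Suc n) -` B \<inter> space \<Omega> \<in> sets \<Omega>" using B measurable_Y by (rule measurable_sets[rotated])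
  have id: "(\<lambda>x. x) \<in> \<Omega> \<rightarrow>\<^sub>M \<F> n"
    using subalgebra_history[of n] by (auto simp: subalgebra_def measurable_def)
  have K: "(\<lambda>\<omega>. P (\<Gamma> n \<omega>) (Y n \<omega>)) \<in> \<Omega> \<rightarrow>\<^sub>M prob_algebra borel"
    using measurable_compose[OF id current_kernel_measurable] by simp
  have m[measurable]: "(\<lambda>\<omega>. measure (P (\<Gamma> n \<omega>) (Y n \<omega>)) B) \<in> borel_measurable \<Omega>"
    by (rule measurable_compose[OF K measurable_measure_prob_algebra[OF B]])
  have p: "prob_space (P (\<Gamma> n \<omega>) (Y n \<omega>))" if "\<omega> \<in> space \<Omega>" for \<omega>
    using transition_kernelD(1)[OF current_kernel[OF that]] .
  have ind: "integrable \<Omega> (\<lambda>\<omega>. indicator B (Y (Suc n) \<omega>) :: real)"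
    using measurable_Y[of "Suc n"] B by (intro \<Omega>.integrable_const_bound[where B=1]) (auto simp: indicator_def)
  have "measure \<Omega> (A \<inter> (Y (Suc n) -` B \<inter> space \<Omega>)) = (\<integral>\<omega>\<in>A. indicator B (Y (Suc n) \<omega>) \<partial>\<Omega>)"
  proof -
    have "(\<integral>\<omega>\<in>A. indicator B (Y (Suc n) \<omega>) \<partial>\<Omega>) = (\<integral>\<omega>. indicat_real (A \<inter> (Y (Suc n) -` B \<inter> space \<Omega>)) \<omega> \<partial>\<Omega>)"
      unfolding set_lebesgue_integral_def
      by (intro Bochner_Integration.integral_cong) (auto simp: indicator_def)
    then show ?thesis by (simp add: Int_absorb2 sets.sets_into_space)
  qed
  also have "\<dots> = (\<integral>\<omega>\<in>A. real_cond_exp \<Omega> (\<F> n) (\<lambda>\<omega>. indicator B (Y (Suc n) \<omega>)) \<omega> \<partial>\<Omega>)"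
    by (rule real_cond_exp_intA[OF ind A])
  also have "\<dots> = (\<integral>\<omega>\<in>A. measure (P (\<Gamma> n \<omega>) (Y n \<omega>)) B \<partial>\<Omega>)"
    unfolding set_lebesgue_integral_def using transition[OF B, of n]
    by (intro integral_cong_AE) (auto intro!: borel_measurable_scaleR)
  finally have eq: "measure \<Omega> (A \<inter> (Y (Suc n) -` B \<inter> space \<Omega>)) =
      (\<integral>\<omega>. indicator A \<omega> * measure (P (\<Gamma> n \<omega>) (Y n \<omega>)) B \<partial>\<Omega>)"
    by (simp add: set_lebesgue_integral_def)
  have i: "integrable \<Omega> (\<lambda>\<omega>. indicator A \<omega> * measure (P (\<Gamma> n \<omega>) (Y n \<omega>)) B)"
    using p by (intro \<Omega>.integrable_const_bound[where B=1]) (auto simp: indicator_def prob_space.prob_le_1)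
  have "(\<integral>\<^sup>+\<omega>. emeasure (P (\<Gamma> n \<omega>) (Y n \<omega>)) B * indicator A \<omega> \<partial>\<Omega>)
      = (\<integral>\<^sup>+\<omega>. ennreal (indicator A \<omega> * measure (P (\<Gamma> n \<omega>) (Y n \<omega>)) B) \<partial>\<Omega>)"
  proof (rule nn_integral_cong)
    fix \<omega> assume "\<omega> \<in> space \<Omega>"
    then interpret q: prob_space "P (\<Gamma> n \<omega>) (Y n \<omega>)" by (rule p)
    show "emeasure (P (\<Gamma> n \<omega>) (Y n \<omega>)) B * indicator A \<omega> = ennreal (indicator A \<omega> * measure (P (\<Gamma> n \<omega>) (Y n \<omega>)) B)"
      by (simp add: q.emeasure_eq_measure indicator_def)
  qed
  also have "\<dots> = ennreal (\<integral>\<omega>. indicator A \<omega> * measure (P (\<Gamma> n \<omega>) (Y n \<omega>)) B \<partial>\<Omega>)"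
    using i by (intro nn_integral_eq_integral) auto
  finally show "emeasure \<Omega> (A \<inter> (Y (Suc n) -` B \<inter> space \<Omega>))
    = (\<integral>\<^sup>+\<omega>. emeasure (P (\<Gamma> n \<omega>) (Y n \<omega>)) B * indicator A \<omega> \<partial>\<Omega>)"
    by (simp add: \<Omega>.emeasure_eq_measure eq)
qed

lemmas markov_nn_integral = nn_integral_kernel_disintegration[OF prob_space_\<Omega> subalgebra_history
  measurable_Y current_kernel_measurable transition_emeasure]

lemmas markov_integral = integral_kernel_disintegration[OF prob_space_\<Omega> subalgebra_history
  measurable_Y current_kernel_measurable transition_emeasure]

text \<open>The parameter is random, so measurability in \<open>y\<close> for each fixed
  \<open>\<gamma>\<close> would not make the composition with \<open>Y\<close> and
  \<open>\<Gamma>\<close> a random variable.\<close>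

lemma iterate_jointly_measurable:
  assumes g: "g \<in> borel_measurable borel"
  shows "(\<lambda>(y, \<gamma>). (kernel_operator (P \<gamma>) ^^ k) g y) \<in> borel_measurable (borel \<Otimes>\<^sub>M I)"
proof (induction k)
  case 0
  then show ?case using measurable_compose[OF measurable_fst g] by (simp add: case_prod_beta)
next
  case (Suc k)
  \<comment> \<open>Here \<open>z\<close> is the current state with the parameter and
    \<open>y'\<close> the variable of integration; the integrand keeps only the parameter from
    \<open>z\<close>, the current state enters through the measure.\<close>
  have "(\<lambda>(z, y'). (\<lambda>(y, \<gamma>). (kernel_operator (P \<gamma>) ^^ k) g y) (y', snd z)) \<in> borel_measurable ((borel \<Otimes>\<^sub>M I) \<Otimes>\<^sub>M borel)"
    using Suc by measurable
  from integral_measurable_kernel[OF this measurable_prob_algebraD[OF kernel_family_measurable]]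
  show ?case
    by (simp add: kernel_operator_def[where g="(kernel_operator Q ^^ k) g" for Q] case_prod_beta)
qed

lemma poisson_solution_jointly_measurable:
  assumes "g \<in> borel_measurable borel"
  shows "(\<lambda>(y, \<gamma>). poisson_solution (P \<gamma>) g y) \<in> borel_measurable (borel \<Otimes>\<^sub>M I)"
  using iterate_jointly_measurable[OF assms]
  unfolding poisson_solution_def case_prod_beta by (intro borel_measurable_suminf)

end


section \<open>Adaptation times and the ergodic sums\<close>

lemma air_time_strict_mono: "strict_mono (air_time \<beta>)"
proof (rule strict_mono_Suc_iff[THEN iffD2], rule allI)
  fix n
  have "0 < real (Suc n) powr \<beta>" by simp
  then have "0 < air_lag \<beta> (Suc n)" unfolding air_lag_def by simp
  then show "air_time \<beta> n < air_time \<beta> (Suc n)" by (simp add: air_time_def)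
qed

text \<open>Pairing the summands \<open>j\<close> and \<open>m + 1 - j\<close>, one of which is at least \<open>m / 2\<close>.\<close>

lemma air_time_ge:
  assumes "0 < \<beta>"
  shows "(real m / 2) powr (1 + \<beta>) \<le> real (air_time \<beta> m)"
proof (cases "m = 0")
  case False
  have ge: "(real m / 2) powr \<beta> \<le> real j powr \<beta> + real (m + 1 - j) powr \<beta>" if j: "j \<in> {1..m}" for j
  proof (cases "real m / 2 \<le> real j")
    case True
    then have "(real m / 2) powr \<beta> \<le> real j powr \<beta>" using assms by (intro powr_mono2) auto
    then show ?thesis by (smt (verit) powr_ge_zero)
  next
    case False
    then have "real m / 2 \<le> real (m + 1 - j)" using j by (simp add: of_nat_diff field_simps)
    then have "(real m / 2) powr \<beta> \<le> real (m + 1 - j) powr \<beta>" using assms by (intro powr_mono2) auto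
    then show ?thesis by (smt (verit) powr_ge_zero)
  qed
  have "(\<Sum>j=1..m. real j powr \<beta>) = (\<Sum>j=1..m. real (m + 1 - j) powr \<beta>)"
    by (rule sum.reindex_bij_witness[where i="\<lambda>j. m + 1 - j" and j="\<lambda>j. m + 1 - j"]) auto
  then have "2 * (\<Sum>j=1..m. real j powr \<beta>) = (\<Sum>j=1..m. real j powr \<beta> + real (m + 1 - j) powr \<beta>)"
    by (simp add: sum.distrib)
  also have "\<dots> \<ge> (\<Sum>j=1..m. (real m / 2) powr \<beta>)" by (intro sum_mono ge)
  finally have "real m / 2 * (real m / 2) powr \<beta> \<le> (\<Sum>j=1..m. real j powr \<beta>)" by simp
  also have "\<dots> \<le> (\<Sum>j=1..m. real (air_lag \<beta> j))"
    unfolding air_lag_def by (intro sum_mono) linarith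
  finally show ?thesis using False by (simp add: air_time_def powr_add)
qed simp

text \<open>Inverts the lower bound for \<open>air_time\<close>: from
  \<open>(m / 2) powr (1 + \<beta>) \<le> n\<close> follows
  \<open>m \<le> 2 * n powr (1 / (1 + \<beta>))\<close>.\<close>

lemma card_air_times_le:
  assumes "0 < \<beta>"
  shows "finite {m. 1 \<le> m \<and> air_time \<beta> m \<le> n}"
    and "real (card {m. 1 \<le> m \<and> air_time \<beta> m \<le> n}) \<le> 2 * real n powr (1 / (1 + \<beta>))"
proof -
  let ?r = "2 * real n powr (1 / (1 + \<beta>))"
  have "m \<le> nat \<lfloor>?r\<rfloor>" if "air_time \<beta> m \<le> n" for m
  proof -
    have "(real m / 2) powr (1 + \<beta>) \<le> real n"
      using air_time_ge[OF assms, of m] that by linarith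
    then have "((real m / 2) powr (1 + \<beta>)) powr (1 / (1 + \<beta>)) \<le> real n powr (1 / (1 + \<beta>))"
      using assms by (intro powr_mono2) auto
    then have "real m \<le> ?r" using assms by (simp add: powr_powr)
    then show ?thesis by linarith
  qed
  then have sub: "{m. 1 \<le> m \<and> air_time \<beta> m \<le> n} \<subseteq> {1..nat \<lfloor>?r\<rfloor>}" by auto
  then show "finite {m. 1 \<le> m \<and> air_time \<beta> m \<le> n}" by (rule finite_subset) simp
  have "card {m. 1 \<le> m \<and> air_time \<beta> m \<le> n} \<le> nat \<lfloor>?r\<rfloor>"
    using card_mono[OF _ sub] by simp
  moreover have "0 \<le> ?r" by simp
  ultimately show "real (card {m. 1 \<le> m \<and> air_time \<beta> m \<le> n}) \<le> ?r" by linarith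
qed

text \<open>Summation by parts: what remains is a sum over the changes of the first argument.\<close>

lemma sum_shifted_difference:
  fixes x :: "nat \<Rightarrow> nat \<Rightarrow> real"
  shows "(\<Sum>i<Suc m. x (Suc i) (Suc i) - x (Suc i) (Suc (Suc i))) =
    x 1 1 - x (Suc m) (Suc (Suc m)) + (\<Sum>i<m. x (Suc (Suc i)) (Suc (Suc i)) - x (Suc i) (Suc (Suc i)))"
  by (induction m) auto

context air_mcmc_chain
begin

lemma parameter_change_times:
  assumes \<omega>: "\<omega> \<in> space \<Omega>" and ne: "\<Gamma> (Suc j) \<omega> \<noteq> \<Gamma> j \<omega>"
  shows "\<exists>m\<ge>1. Suc j = air_time \<beta> m"
proof -
  have mono: "strict_mono (air_time \<beta>)" by (rule air_time_strict_mono)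
  have T0: "air_time \<beta> 0 = 0" by (simp add: air_time_def)
  have ex: "\<exists>m. j < air_time \<beta> m"
    using strict_mono_imp_increasing[OF mono, of "Suc j"] by (auto intro!: exI[of _ "Suc j"])
  \<comment> \<open>Minimality locates \<open>j\<close> in the block that ends just before
    \<open>air_time \<beta> m\<close>. A change of parameter pushes \<open>Suc j\<close> out of this
    block, that is, to its right end point.\<close>
  define m where "m = (LEAST m. j < air_time \<beta> m)"
  have jm: "j < air_time \<beta> m" unfolding m_def using ex by (rule LeastI_ex)
  then obtain k where k: "m = Suc k" using T0 by (cases m) auto
  have kj: "air_time \<beta> k \<le> j"
    using not_less_Least[of k "\<lambda>m. j < air_time \<beta> m"] k by (simp add: m_def)
  have "\<not> Suc j < air_time \<beta> (Suc k)"
    using adaptation_times[OF \<omega>, of "Suc j" k j] ne kj jm k by auto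
  then have "Suc j = air_time \<beta> (Suc k)" using jm k by simp
  then show ?thesis by (intro exI[of _ "Suc k"]) simp
qed

lemma card_parameter_changes:
  assumes "0 < \<beta>" and \<omega>: "\<omega> \<in> space \<Omega>"
  shows "real (card {i. i < m \<and> \<Gamma> (Suc (Suc i)) \<omega> \<noteq> \<Gamma> (Suc i) \<omega>}) \<le> 2 * real (Suc m) powr (1 / (1 + \<beta>))"
proof -
  let ?A = "{i. i < m \<and> \<Gamma> (Suc (Suc i)) \<omega> \<noteq> \<Gamma> (Suc i) \<omega>}"
  let ?B = "{k. 1 \<le> k \<and> air_time \<beta> k \<le> Suc m}"
  \<comment> \<open>A change between the times \<open>Suc i\<close> and \<open>Suc (Suc i)\<close>
    makes the latter an adaptation time, at most \<open>Suc m\<close> because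
    \<open>i < m\<close>.\<close>
  have "(\<lambda>i. Suc (Suc i)) ` ?A \<subseteq> air_time \<beta> ` ?B"
    using parameter_change_times[OF \<omega>] by fastforce
  then have "card ((\<lambda>i. Suc (Suc i)) ` ?A) \<le> card (air_time \<beta> ` ?B)"
    by (intro card_mono finite_imageI card_air_times_le(1)[OF assms(1)])
  also have "card ((\<lambda>i. Suc (Suc i)) ` ?A) = card ?A" by (rule card_image) (auto simp: inj_on_def)
  also have "card (air_time \<beta> ` ?B) \<le> card ?B" by (rule card_image_le[OF card_air_times_le(1)[OF assms(1)]])
  finally show ?thesis using card_air_times_le(2)[OF assms(1), of "Suc m"] by linarith
qed

text \<open>Summation by parts leaves two boundary terms and one term per change of parameter. The
  constant is \<open>1\<close> for the boundary at time 1, \<open>2 powr e\<close> for the one at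
  time \<open>Suc n \<le> 2 * n\<close>, and \<open>4 = 2 * 2\<close> for the changes:
  \<open>2\<close> from their number, \<open>2\<close> from the triangle inequality.\<close>

lemma sum_adapted_difference_bound:
  fixes h :: "'i \<Rightarrow> 'x \<times> 'p \<Rightarrow> real"
  assumes "0 < \<beta>" and \<omega>: "\<omega> \<in> space \<Omega>" and e: "0 \<le> e" and c: "0 \<le> c" and n: "1 \<le> n"
    and h: "\<And>j k. 1 \<le> k \<Longrightarrow> \<bar>h (\<Gamma> j \<omega>) (Y k \<omega>)\<bar> \<le> c * real k powr e"
  shows "\<bar>\<Sum>i<n. h (\<Gamma> (Suc i) \<omega>) (Y (Suc i) \<omega>) - h (\<Gamma> (Suc i) \<omega>) (Y (Suc (Suc i)) \<omega>)\<bar>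
    \<le> c * (5 + 2 powr e) * real n powr (1 / (1 + \<beta>) + e)"
proof -
  obtain m where m: "n = Suc m" using n by (cases n) auto
  define x where "x j k = h (\<Gamma> j \<omega>) (Y k \<omega>)" for j k
  let ?A = "{i. i < m \<and> \<Gamma> (Suc (Suc i)) \<omega> \<noteq> \<Gamma> (Suc i) \<omega>}"
  let ?N = "real n powr (1 / (1 + \<beta>) + e)"
  have x: "\<bar>x j k\<bar> \<le> c * real k powr e" if "1 \<le> k" for j k using h[OF that] by (simp add: x_def)
  have N: "real n powr e \<le> ?N" "1 \<le> ?N" using assms(1) n e
    by (auto intro!: powr_mono ge_one_powr_ge_zero add_nonneg_nonneg)
  have x1: "\<bar>x 1 1\<bar> \<le> c * ?N"
    using x[of 1 1] mult_left_mono[OF N(2) c] by simp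
  have x2: "\<bar>x n (Suc n)\<bar> \<le> c * (2 powr e * ?N)"
  proof -
    have "real (Suc n) powr e \<le> (2 * real n) powr e" using n e by (intro powr_mono2) auto
    also have "\<dots> = 2 powr e * real n powr e" by (simp add: powr_mult)
    also have "\<dots> \<le> 2 powr e * ?N" using N by (intro mult_left_mono) auto
    finally have "c * real (Suc n) powr e \<le> c * (2 powr e * ?N)" using c by (rule mult_left_mono)
    then show ?thesis using x[of "Suc n" n] by linarith
  qed
  have x3: "\<bar>\<Sum>i<m. x (Suc (Suc i)) (Suc (Suc i)) - x (Suc i) (Suc (Suc i))\<bar> \<le> c * (4 * ?N)"
  proof -
    have "\<bar>\<Sum>i<m. x (Suc (Suc i)) (Suc (Suc i)) - x (Suc i) (Suc (Suc i))\<bar>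
        = \<bar>\<Sum>i\<in>?A. x (Suc (Suc i)) (Suc (Suc i)) - x (Suc i) (Suc (Suc i))\<bar>"
      by (intro arg_cong[where f=abs] sum.mono_neutral_right) (auto simp: x_def)
    also have "\<dots> \<le> (\<Sum>i\<in>?A. \<bar>x (Suc (Suc i)) (Suc (Suc i)) - x (Suc i) (Suc (Suc i))\<bar>)" by (rule sum_abs)
    also have "\<dots> \<le> (\<Sum>i\<in>?A. 2 * (c * real n powr e))"
    proof (rule sum_mono)
      fix i assume "i \<in> ?A"
      then have "real (Suc (Suc i)) powr e \<le> real n powr e" using m e by (intro powr_mono2) auto
      then have "c * real (Suc (Suc i)) powr e \<le> c * real n powr e" using c by (rule mult_left_mono)
      moreover have "\<bar>x (Suc (Suc i)) (Suc (Suc i)) - x (Suc i) (Suc (Suc i))\<bar>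
          \<le> \<bar>x (Suc (Suc i)) (Suc (Suc i))\<bar> + \<bar>x (Suc i) (Suc (Suc i))\<bar>" by (rule abs_triangle_ineq4)
      ultimately show "\<bar>x (Suc (Suc i)) (Suc (Suc i)) - x (Suc i) (Suc (Suc i))\<bar> \<le> 2 * (c * real n powr e)"
        using x[of "Suc (Suc i)" "Suc (Suc i)"] x[of "Suc (Suc i)" "Suc i"] by linarith
    qed
    also have "\<dots> = real (card ?A) * (2 * (c * real n powr e))" by simp
    also have "\<dots> \<le> (2 * real n powr (1 / (1 + \<beta>))) * (2 * (c * real n powr e))"
      using card_parameter_changes[OF assms(1) \<omega>, of m] c m by (intro mult_right_mono) auto
    also have "\<dots> = c * (4 * ?N)" by (simp add: powr_add)
    finally show ?thesis .
  qed
  have "\<bar>\<Sum>i<n. x (Suc i) (Suc i) - x (Suc i) (Suc (Suc i))\<bar> \<le> c * ?N + c * (2 powr e * ?N) + c * (4 * ?N)"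
    unfolding m sum_shifted_difference using x1 x2 x3 unfolding m by linarith
  then show ?thesis by (simp add: x_def algebra_simps)
qed

end

section \<open>The chain under contraction and drift with constants common to all parameters\<close>

locale contracting_air_chain = air_mcmc_chain \<nu> I \<pi> P \<beta> \<Omega> Y \<Gamma>
  for \<nu> :: "'x::polish_space measure"
    and I :: "'i measure"
    and \<pi> :: "'i \<Rightarrow> ('x \<times> 'p::polish_space) measure"
    and P :: "'i \<Rightarrow> 'x \<times> 'p \<Rightarrow> ('x \<times> 'p) measure"
    and \<beta> :: real
    and \<Omega> :: "'w measure"
    and Y :: "nat \<Rightarrow> 'w \<Rightarrow> 'x \<times> 'p"
    and \<Gamma> :: "nat \<Rightarrow> 'w \<Rightarrow> 'i" +
  fixes d :: "'x \<times> 'p \<Rightarrow> 'x \<times> 'p \<Rightarrow> real"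
    and V :: "'x \<times> 'p \<Rightarrow> real"
    and f :: "'x \<Rightarrow> real"
    and M \<tau> \<kappa> b p K L :: real
    and k0 :: nat
  assumes distance_like: "distance_like d"
    and M: "1 \<le> M" and \<tau>: "\<tau> < 1" and k0: "1 \<le> k0"
    and contraction_M: "\<And>\<gamma>. \<gamma> \<in> space I \<Longrightarrow> contraction_coeff d (P \<gamma>) \<le> ennreal M"
    and contraction_\<tau>: "\<And>\<gamma>. \<gamma> \<in> space I \<Longrightarrow> contraction_coeff d (kernel_pow (P \<gamma>) k0) \<le> ennreal \<tau>"
    and V[measurable]: "V \<in> borel_measurable borel" and V_ge_1: "\<And>y. 1 \<le> V y"
    and \<kappa>: "0 < \<kappa>" "\<kappa> < 1" and b: "0 < b"
    and drift: "\<And>\<gamma> y. \<gamma> \<in> space I \<Longrightarrow> (\<integral>\<^sup>+y'. ennreal (V y') \<partial>P \<gamma> y) \<le> ennreal (\<kappa> * V y + b)"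
    and p: "2 < p" and K: "0 < K"
    and d_le: "\<And>y1 y2. d y1 y2 \<le> K * (V y1 powr (1 / p) + V y2 powr (1 / p))"
    and f: "f \<in> borel_measurable borel"
    and L: "0 < L" and lipschitz: "lipschitz_wrt d L (\<lambda>(x, \<phi>). f x)"
    and f_le: "\<And>x \<phi>. \<bar>f x\<bar> \<le> V (x, \<phi>) powr (1 / p)"
begin

definition U :: "'x \<times> 'p \<Rightarrow> real" where "U y = V y powr (1 / p)"
definition g :: "'x \<times> 'p \<Rightarrow> real" where "g y = f (fst y) - (\<integral>x. f x \<partial>\<nu>)"

lemma U_measurable[measurable]: "U \<in> borel_measurable borel"
  unfolding U_def by measurable

lemma V_nonneg[simp]: "0 \<le> V y"
  using V_ge_1[of y] by simp

lemma f_fst_measurable: "(\<lambda>y::'x \<times> 'p. f (fst y)) \<in> borel_measurable borel"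
  using measurable_compose[OF measurable_fst f, of "borel :: 'p measure"] by (simp only: borel_prod)

lemma g_measurable[measurable]: "g \<in> borel_measurable borel"
  unfolding g_def using f_fst_measurable by simp

lemma U_ge_1: "1 \<le> U y"
  using V_ge_1[of y] p by (simp add: U_def ge_one_powr_ge_zero)

text \<open>The exponent \<open>2 / p\<close> is at most 1. Hence first moments of \<open>V\<close>
  along the chain bound second moments of everything of order \<open>U\<close>.\<close>

lemma U_sq_le: "U y * U y \<le> V y"
proof -
  have "U y * U y = V y powr (2 / p)" by (simp add: U_def flip: powr_add)
  also have "\<dots> \<le> V y powr 1" using V_ge_1[of y] p by (intro powr_mono) auto
  finally show ?thesis using V_ge_1[of y] by simp
qed

lemma U_le: "U y \<le> V y"
proof -
  have "1 * U y \<le> U y * U y"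
    using U_ge_1[of y] by (intro mult_right_mono) auto
  then show ?thesis using U_sq_le[of y] by linarith
qed

lemma g_le: "\<bar>g y\<bar> \<le> (1 + \<bar>\<integral>x. f x \<partial>\<nu>\<bar>) * U y"
proof -
  have "\<bar>g y\<bar> \<le> U y + \<bar>\<integral>x. f x \<partial>\<nu>\<bar> * 1"
    using f_le[of "fst y" "snd y"] by (simp add: g_def U_def)
  also have "\<dots> \<le> U y + \<bar>\<integral>x. f x \<partial>\<nu>\<bar> * U y"
    using U_ge_1 by (intro add_left_mono mult_left_mono) auto
  finally show ?thesis by (simp add: algebra_simps)
qed

lemma invariant_drift_kernel: "\<gamma> \<in> space I \<Longrightarrow> invariant_drift_kernel (P \<gamma>) V \<kappa> b (\<pi> \<gamma>)"
  using V_ge_1 \<kappa> b drift kernel invariant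
  by unfold_locales auto

lemma dominated_f:
  assumes "\<gamma> \<in> space I"
  shows "drift_kernel.dominated V (\<lambda>y. f (fst y))" "drift_kernel.dominated V g"
proof -
  interpret invariant_drift_kernel "P \<gamma>" V \<kappa> b "\<pi> \<gamma>" using assms by (rule invariant_drift_kernel)
  have 1: "\<bar>f (fst y)\<bar> \<le> 1 * V y" for y
    using f_le[of "fst y" "snd y"] U_le[of y] by (simp add: U_def)
  have 2: "\<bar>g y\<bar> \<le> (1 + \<bar>\<integral>x. f x \<partial>\<nu>\<bar>) * V y" for y
  proof -
    have "(1 + \<bar>\<integral>x. f x \<partial>\<nu>\<bar>) * U y \<le> (1 + \<bar>\<integral>x. f x \<partial>\<nu>\<bar>) * V y"
      using U_le by (intro mult_left_mono) auto
    then show ?thesis using g_le[of y] by linarith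
  qed
  show "dominated (\<lambda>y. f (fst y))"
    unfolding dominated_def using f_fst_measurable 1 by blast
  show "dominated g" unfolding dominated_def using 2 by auto
qed

text \<open>All \<open>\<pi> \<gamma>\<close> share the first marginal \<open>\<nu>\<close>, so one
  centring constant serves every parameter; this is where the dependence of \<open>f\<close> on the
  first coordinate alone enters.\<close>

lemma integral_g: assumes "\<gamma> \<in> space I" shows "(\<integral>y. g y \<partial>\<pi> \<gamma>) = 0"
proof -
  interpret invariant_drift_kernel "P \<gamma>" V \<kappa> b "\<pi> \<gamma>" using assms by (rule invariant_drift_kernel)
  interpret prob_space "\<pi> \<gamma>" by (rule invariant_facts)
  have m: "fst \<in> \<pi> \<gamma> \<rightarrow>\<^sub>M borel"
    unfolding measurable_cong_sets[OF invariant_facts(2) refl] by (simp flip: borel_prod)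
  have "\<nu> = distr (\<pi> \<gamma>) borel fst"
  proof (rule measure_eqI)
    show "sets \<nu> = sets (distr (\<pi> \<gamma>) borel fst)" by (simp add: sets_\<nu>)
    fix B assume "B \<in> sets \<nu>"
    then have B: "B \<in> sets borel" by (simp add: sets_\<nu>)
    have "fst -` B \<inter> space (\<pi> \<gamma>) = B \<times> UNIV" by (auto simp: invariant_facts)
    then show "emeasure \<nu> B = emeasure (distr (\<pi> \<gamma>) borel fst) B"
      using marginal[OF assms B] by (simp add: emeasure_distr[OF m B])
  qed
  then have "(\<integral>x. f x \<partial>\<nu>) = (\<integral>y. f (fst y) \<partial>\<pi> \<gamma>)"
    using integral_distr[OF m f] by simp
  then show ?thesis
    using integrable_invariant[OF dominated_f(1)[OF assms]] by (simp add: g_def prob_space)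
qed

text \<open>A contraction factor \<open>\<tau> = 0\<close> is replaced by a positive one, since
  \<open>lipschitz_wrt_kernel_operator\<close> divides by the Lipschitz constant.\<close>

definition "\<tau>' = max \<tau> (1 / 2)"
definition "rate k = L * M ^ (k mod k0) * \<tau>' ^ (k div k0) * (K * (1 + b / (1 - \<kappa>)))"
text \<open>Bounds the \<open>U\<close>-weighted supremum norm of the Poisson solutions for all
  parameters simultaneously.\<close>

definition "total_rate = suminf rate"
definition "poisson \<gamma> = poisson_solution (P \<gamma>) g"

lemma rate: "summable rate" "0 \<le> rate k"
proof -
  have "summable (\<lambda>k. L * (M ^ (k mod k0) * \<tau>' ^ (k div k0)) * (K * (1 + b / (1 - \<kappa>))))"
    using M \<tau> k0 by (intro summable_mult summable_mult2 summable_power_mod_div) (auto simp: \<tau>'_def)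
  then show "summable rate" by (simp add: rate_def[abs_def] mult.assoc)
  show "0 \<le> rate k" using L M K b \<kappa> by (auto simp: rate_def \<tau>'_def intro!: mult_nonneg_nonneg add_nonneg_nonneg)
qed

lemma total_rate_nonneg: "0 \<le> total_rate"
  unfolding total_rate_def using rate by (intro suminf_nonneg) auto

lemma poisson:
  assumes \<gamma>: "\<gamma> \<in> space I"
  shows "\<bar>poisson \<gamma> y\<bar> \<le> total_rate * U y"
    and "integrable (P \<gamma> y) (poisson \<gamma>)"
    and "(\<integral>y'. poisson \<gamma> y' \<partial>P \<gamma> y) = poisson \<gamma> y - g y"
proof -
  interpret invariant_drift_kernel "P \<gamma>" V \<kappa> b "\<pi> \<gamma>" using \<gamma> by (rule invariant_drift_kernel)
  have "\<bar>(kernel_operator (P \<gamma>) ^^ k) g y\<bar> \<le> rate k * U y" for k y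
    unfolding rate_def
  proof (rule iterate_bound[OF distance_like _ _ L K contraction_M[OF \<gamma>]])
    show "contraction_coeff d (kernel_pow (P \<gamma>) k0) \<le> ennreal \<tau>'"
      using contraction_\<tau>[OF \<gamma>] by (rule order_trans) (simp add: \<tau>'_def ennreal_leI)
    show "lipschitz_wrt d L g" using lipschitz by (auto simp: lipschitz_wrt_def g_def)
    show "d y1 y2 \<le> K * (U y1 + U y2)" for y1 y2 using d_le by (simp add: U_def)
  qed (use M U_ge_1 U_le dominated_f[OF \<gamma>] integral_g[OF \<gamma>] in \<open>auto simp: \<tau>'_def\<close>)
  note s = poisson_solution[OF dominated_f(2)[OF \<gamma>] order_trans[OF zero_le_one U_ge_1] U_le rate this]
  show "\<bar>poisson \<gamma> y\<bar> \<le> total_rate * U y" using s(1) by (simp add: poisson_def total_rate_def)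
  show "integrable (P \<gamma> y) (poisson \<gamma>)" using integrable_kernel[OF s(2)] by (simp add: poisson_def)
  show "(\<integral>y'. poisson \<gamma> y' \<partial>P \<gamma> y) = poisson \<gamma> y - g y" using s(3) by (simp add: poisson_def kernel_operator_def)
qed

lemma \<Gamma>_space: "\<omega> \<in> space \<Omega> \<Longrightarrow> \<Gamma> n \<omega> \<in> space I"
  using measurable_space[OF measurable_\<Gamma>] .

lemma poisson_measurable: "(\<lambda>(y, \<gamma>). poisson \<gamma> y) \<in> borel_measurable (borel \<Otimes>\<^sub>M I)"
  unfolding poisson_def by (rule poisson_solution_jointly_measurable) measurable

text \<open>The drift constants do not depend on the parameter, so the recursion for the
  expectations of \<open>V\<close> is unaffected by adaptation; the deterministic start makes the
  initial moment finite.\<close>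

lemma moment_bound: "\<exists>c\<ge>0. \<forall>n. (\<integral>\<^sup>+\<omega>. ennreal (V (Y n \<omega>)) \<partial>\<Omega>) \<le> ennreal c"
proof -
  interpret \<Omega>: prob_space \<Omega> by (rule prob_space_\<Omega>)
  obtain y0 where y0: "\<And>\<omega>. \<omega> \<in> space \<Omega> \<Longrightarrow> Y 0 \<omega> = y0" using deterministic_start by blast
  \<comment> \<open>\<open>b / (1 - \<kappa>)\<close> is the fixed point of
    \<open>x \<mapsto> \<kappa> * x + b\<close>. A level above it is not exceeded by the recursion,
    and adding \<open>V y0\<close> covers the start.\<close>
  define c where "c = V y0 + b / (1 - \<kappa>)"
  have b0: "0 \<le> b / (1 - \<kappa>)" using b \<kappa> by simp
  have c: "0 \<le> c" using V_ge_1[of y0] b0 by (simp add: c_def)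
  have cb: "\<kappa> * c + b \<le> c"
  proof -
    have "b = b / (1 - \<kappa>) * (1 - \<kappa>)" using \<kappa> by simp
    also have "\<dots> \<le> c * (1 - \<kappa>)"
      using \<kappa> by (intro mult_right_mono) (auto simp: c_def)
    finally show ?thesis by (simp add: algebra_simps)
  qed
  have "(\<integral>\<^sup>+\<omega>. ennreal (V (Y n \<omega>)) \<partial>\<Omega>) \<le> ennreal c" for n
  proof (induction n)
    case 0
    have "(\<integral>\<^sup>+\<omega>. ennreal (V (Y 0 \<omega>)) \<partial>\<Omega>) = (\<integral>\<^sup>+\<omega>. ennreal (V y0) \<partial>\<Omega>)"
      by (intro nn_integral_cong) (simp add: y0)
    also have "\<dots> \<le> ennreal c" using b0 by (auto simp: \<Omega>.emeasure_space_1 c_def intro!: ennreal_leI)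
    finally show ?case .
  next
    case (Suc n)
    have [measurable]: "Y n \<in> \<Omega> \<rightarrow>\<^sub>M borel" by (rule measurable_Y)
    have "(\<integral>\<^sup>+\<omega>. ennreal (V (Y (Suc n) \<omega>)) \<partial>\<Omega>) =
        (\<integral>\<^sup>+\<omega>. (\<integral>\<^sup>+y. ennreal (V y) \<partial>P (\<Gamma> n \<omega>) (Y n \<omega>)) \<partial>\<Omega>)"
      by (rule markov_nn_integral) measurable
    also have "\<dots> \<le> (\<integral>\<^sup>+\<omega>. ennreal \<kappa> * ennreal (V (Y n \<omega>)) + ennreal b \<partial>\<Omega>)"
    proof (rule nn_integral_mono)
      fix \<omega> assume "\<omega> \<in> space \<Omega>"
      then have "(\<integral>\<^sup>+y. ennreal (V y) \<partial>P (\<Gamma> n \<omega>) (Y n \<omega>)) \<le> ennreal (\<kappa> * V (Y n \<omega>) + b)"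
        by (intro drift \<Gamma>_space)
      also have "\<dots> = ennreal \<kappa> * ennreal (V (Y n \<omega>)) + ennreal b"
        using \<kappa> b V_ge_1[of "Y n \<omega>"] by (subst ennreal_plus) (auto simp: ennreal_mult')
      finally show "(\<integral>\<^sup>+y. ennreal (V y) \<partial>P (\<Gamma> n \<omega>) (Y n \<omega>)) \<le> ennreal \<kappa> * ennreal (V (Y n \<omega>)) + ennreal b" .
    qed
    also have "\<dots> = ennreal \<kappa> * (\<integral>\<^sup>+\<omega>. ennreal (V (Y n \<omega>)) \<partial>\<Omega>) + ennreal b"
      by (subst nn_integral_add) (auto simp: nn_integral_cmult \<Omega>.emeasure_space_1)
    also have "\<dots> \<le> ennreal \<kappa> * ennreal c + ennreal b"
      using Suc by (intro add_right_mono mult_left_mono) auto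
    also have "\<dots> = ennreal (\<kappa> * c + b)"
      using \<kappa> c b by (simp add: ennreal_mult'[symmetric] ennreal_plus[symmetric] del: ennreal_plus)
    also have "\<dots> \<le> ennreal c" using cb by (rule ennreal_leI)
    finally show ?case .
  qed
  then show ?thesis using c by blast
qed

lemma V_moment:
  shows "integrable \<Omega> (\<lambda>\<omega>. V (Y n \<omega>))" and "\<exists>c. \<forall>n. (\<integral>\<omega>. V (Y n \<omega>) \<partial>\<Omega>) \<le> c"
proof -
  obtain c where c: "0 \<le> c" "\<And>n. (\<integral>\<^sup>+\<omega>. ennreal (V (Y n \<omega>)) \<partial>\<Omega>) \<le> ennreal c"
    using moment_bound by blast
  have i: "integrable \<Omega> (\<lambda>\<omega>. V (Y n \<omega>))" for n
    using c(2)[of n] measurable_compose[OF measurable_Y V]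
    by (intro integrableI_nonneg) (auto intro: le_less_trans)
  then show "integrable \<Omega> (\<lambda>\<omega>. V (Y n \<omega>))" .
  have "(\<integral>\<omega>. V (Y n \<omega>) \<partial>\<Omega>) \<le> c" for n
  proof -
    have "ennreal (\<integral>\<omega>. V (Y n \<omega>) \<partial>\<Omega>) = (\<integral>\<^sup>+\<omega>. ennreal (V (Y n \<omega>)) \<partial>\<Omega>)"
      using i by (intro nn_integral_eq_integral[symmetric]) auto
    then show ?thesis using c by (metis ennreal_le_iff)
  qed
  then show "\<exists>c. \<forall>n. (\<integral>\<omega>. V (Y n \<omega>) \<partial>\<Omega>) \<le> c" by blast
qed

text \<open>The martingale difference at time \<open>Suc j\<close>; the shift matches sums over
  \<open>i < n\<close> with ergodic sums over \<open>1..n\<close>. The one-step mean of the Poisson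
  solution is written as solution minus \<open>g\<close>, which makes measurability
  immediate.\<close>

definition increment :: "nat \<Rightarrow> 'w \<Rightarrow> real" where
  "increment j \<omega> = poisson (\<Gamma> (Suc j) \<omega>) (Y (Suc (Suc j)) \<omega>)
    - (poisson (\<Gamma> (Suc j) \<omega>) (Y (Suc j) \<omega>) - g (Y (Suc j) \<omega>))"

lemma poisson_history_measurable:
  assumes "i \<le> n" "j \<le> n"
  shows "(\<lambda>\<omega>. poisson (\<Gamma> i \<omega>) (Y j \<omega>)) \<in> borel_measurable (\<F> n)"
proof -
  have "(\<lambda>\<omega>. (Y j \<omega>, \<Gamma> i \<omega>)) \<in> \<F> n \<rightarrow>\<^sub>M borel \<Otimes>\<^sub>M I"
    using measurable_history assms by simp
  from measurable_compose[OF this poisson_measurable] show ?thesis by simp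
qed

lemma increment_history_measurable: "Suc (Suc j) \<le> n \<Longrightarrow> increment j \<in> borel_measurable (\<F> n)"
  unfolding increment_def using measurable_compose[OF measurable_history(1) g_measurable]
  by (intro borel_measurable_diff poisson_history_measurable) auto

lemma increment_measurable: "increment j \<in> borel_measurable \<Omega>"
  by (rule measurable_from_subalg[OF subalgebra_history increment_history_measurable[OF order_refl]])

definition "increment_const = total_rate + (1 + \<bar>\<integral>x. f x \<partial>\<nu>\<bar>)"

lemma increment_sq_le:
  assumes "\<omega> \<in> space \<Omega>"
  shows "increment j \<omega> * increment j \<omega> \<le> 2 * increment_const\<^sup>2 * (V (Y (Suc (Suc j)) \<omega>) + V (Y (Suc j) \<omega>))"
proof -
  let ?u = "U (Y (Suc (Suc j)) \<omega>)" and ?v = "U (Y (Suc j) \<omega>)"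
  have increment_const: "0 \<le> increment_const" using total_rate_nonneg by (simp add: increment_const_def)
  have "\<bar>increment j \<omega>\<bar> \<le> total_rate * ?u + total_rate * ?v + (1 + \<bar>\<integral>x. f x \<partial>\<nu>\<bar>) * ?v"
    using poisson(1)[OF \<Gamma>_space[OF assms, of "Suc j"], of "Y (Suc (Suc j)) \<omega>"]
      poisson(1)[OF \<Gamma>_space[OF assms, of "Suc j"], of "Y (Suc j) \<omega>"] g_le[of "Y (Suc j) \<omega>"]
    unfolding increment_def by linarith
  also have "\<dots> \<le> increment_const * (?u + ?v)"
  proof -
    have "0 \<le> (1 + \<bar>\<integral>x. f x \<partial>\<nu>\<bar>) * ?u" using U_ge_1[of "Y (Suc (Suc j)) \<omega>"] by simp
    then show ?thesis by (simp add: increment_const_def algebra_simps)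
  qed
  finally have "\<bar>increment j \<omega>\<bar>\<^sup>2 \<le> (increment_const * (?u + ?v))\<^sup>2" by (rule power_mono) simp
  then have "increment j \<omega> * increment j \<omega> \<le> (increment_const * (?u + ?v))\<^sup>2" by (simp add: power2_eq_square)
  also have "\<dots> = increment_const\<^sup>2 * (?u + ?v)\<^sup>2" by (simp add: power_mult_distrib)
  also have "\<dots> \<le> increment_const\<^sup>2 * (2 * (?u * ?u + ?v * ?v))"
  proof (rule mult_left_mono)
    have "0 \<le> (?u - ?v)\<^sup>2" by simp
    then show "(?u + ?v)\<^sup>2 \<le> 2 * (?u * ?u + ?v * ?v)" by (simp add: power2_eq_square algebra_simps)
  qed simp
  also have "\<dots> \<le> increment_const\<^sup>2 * (2 * (V (Y (Suc (Suc j)) \<omega>) + V (Y (Suc j) \<omega>)))"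
    using U_sq_le by (intro mult_left_mono add_mono) auto
  finally show ?thesis by (simp add: algebra_simps)
qed

lemma increment_sq_integrable: "integrable \<Omega> (\<lambda>\<omega>. increment j \<omega> * increment j \<omega>)"
proof (rule Bochner_Integration.integrable_bound)
  show "integrable \<Omega> (\<lambda>\<omega>. 2 * increment_const\<^sup>2 * (V (Y (Suc (Suc j)) \<omega>) + V (Y (Suc j) \<omega>)))"
    using V_moment(1) by simp
  show "(\<lambda>\<omega>. increment j \<omega> * increment j \<omega>) \<in> borel_measurable \<Omega>" using increment_measurable by measurable
  show "AE \<omega> in \<Omega>. norm (increment j \<omega> * increment j \<omega>) \<le> norm (2 * increment_const\<^sup>2 * (V (Y (Suc (Suc j)) \<omega>) + V (Y (Suc j) \<omega>)))"
    using increment_sq_le by (intro AE_I2) (auto intro: order_trans[OF _ abs_ge_self])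
qed

lemma increment_prod_integrable: "integrable \<Omega> (\<lambda>\<omega>. increment i \<omega> * increment j \<omega>)"
proof (rule Bochner_Integration.integrable_bound)
  show "integrable \<Omega> (\<lambda>\<omega>. increment i \<omega> * increment i \<omega> + increment j \<omega> * increment j \<omega>)" using increment_sq_integrable by simp
  show "(\<lambda>\<omega>. increment i \<omega> * increment j \<omega>) \<in> borel_measurable \<Omega>"
    using increment_measurable[of i] increment_measurable[of j] by measurable
  have "\<bar>x * y\<bar> \<le> x * x + y * y" for x y :: real
  proof -
    have "2 * (\<bar>x\<bar> * \<bar>y\<bar>) \<le> \<bar>x\<bar>\<^sup>2 + \<bar>y\<bar>\<^sup>2" using sum_squares_bound[of "\<bar>x\<bar>" "\<bar>y\<bar>"] by (simp add: mult.assoc)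
    moreover have "0 \<le> \<bar>x\<bar> * \<bar>y\<bar>" by simp
    ultimately show ?thesis unfolding abs_mult power2_eq_square abs_mult_self_eq by linarith
  qed
  then show "AE \<omega> in \<Omega>. norm (increment i \<omega> * increment j \<omega>) \<le> norm (increment i \<omega> * increment i \<omega> + increment j \<omega> * increment j \<omega>)"
    by (intro AE_I2) (auto intro: order_trans[OF _ abs_ge_self])
qed

text \<open>Because \<open>i < j\<close>, the earlier increment is determined by the history up to
  \<open>Suc j\<close>. It is frozen, together with parameter and state at that time, when the next
  state is integrated out, and the remaining factor has mean 0 by the Poisson equation.\<close>

lemma increment_orthogonal:
  assumes "i < j" shows "(\<integral>\<omega>. increment i \<omega> * increment j \<omega> \<partial>\<Omega>) = 0"
proof -
  let ?n = "Suc j"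
  define R where "R \<omega> = poisson (\<Gamma> ?n \<omega>) (Y ?n \<omega>) - g (Y ?n \<omega>)" for \<omega>
  \<comment> \<open>The two occurrences of \<open>\<omega>\<close> are separated:
    \<open>\<omega>\<close> stands for the history, \<open>y\<close> for the next state.\<close>
  define H where "H \<omega> y = increment i \<omega> * (poisson (\<Gamma> ?n \<omega>) y - R \<omega>)" for \<omega> y
  have DH: "increment i \<omega> * increment j \<omega> = H \<omega> (Y (Suc ?n) \<omega>)" for \<omega>
    by (simp add: H_def R_def increment_def)
  have R: "R \<in> borel_measurable (\<F> ?n)"
    unfolding R_def using measurable_compose[OF measurable_history(1)[OF order_refl] g_measurable]
    by (intro borel_measurable_diff poisson_history_measurable) auto
  have s: "(\<lambda>(\<omega>, y). poisson (\<Gamma> ?n \<omega>) y) \<in> borel_measurable (\<F> ?n \<Otimes>\<^sub>M borel)"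
  proof -
    have "(\<lambda>(\<omega>, y). (y, \<Gamma> ?n \<omega>)) \<in> \<F> ?n \<Otimes>\<^sub>M borel \<rightarrow>\<^sub>M borel \<Otimes>\<^sub>M I"
      using measurable_history(2)[of ?n ?n] by measurable
    from measurable_compose[OF this poisson_measurable] show ?thesis by (simp add: case_prod_beta)
  qed
  have H: "(\<lambda>(\<omega>, y). H \<omega> y) \<in> borel_measurable (\<F> ?n \<Otimes>\<^sub>M borel)"
    unfolding H_def case_prod_beta
    using s R increment_history_measurable[of i ?n] assms unfolding case_prod_beta
    by (intro borel_measurable_times borel_measurable_diff) (auto intro: measurable_compose[OF measurable_fst])
  have "(\<integral>\<omega>. increment i \<omega> * increment j \<omega> \<partial>\<Omega>) = (\<integral>\<omega>. (\<integral>y. H \<omega> y \<partial>P (\<Gamma> ?n \<omega>) (Y ?n \<omega>)) \<partial>\<Omega>)"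
    unfolding DH by (rule markov_integral[OF H]) (use increment_prod_integrable[of i j] in \<open>simp add: DH\<close>)
  also have "\<dots> = (\<integral>\<omega>. 0 \<partial>\<Omega>)"
  proof (rule Bochner_Integration.integral_cong[OF refl])
    fix \<omega> assume w: "\<omega> \<in> space \<Omega>"
    interpret q: prob_space "P (\<Gamma> ?n \<omega>) (Y ?n \<omega>)" by (rule transition_kernelD[OF current_kernel[OF w]])
    show "(\<integral>y. H \<omega> y \<partial>P (\<Gamma> ?n \<omega>) (Y ?n \<omega>)) = 0"
      using poisson(2,3)[OF \<Gamma>_space[OF w, of ?n], of "Y ?n \<omega>"] by (simp add: H_def R_def q.prob_space)
  qed
  finally show ?thesis by simp
qed

lemma increment_sum_growth:
  assumes "1 / 2 < \<alpha>"
  shows "AE \<omega> in \<Omega>. \<exists>C. \<forall>n\<ge>1. \<bar>\<Sum>i<n. increment i \<omega>\<bar> \<le> C * real n powr \<alpha>"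
proof -
  obtain c where c: "\<And>n. (\<integral>\<omega>. V (Y n \<omega>) \<partial>\<Omega>) \<le> c" using V_moment(2) by blast
  show ?thesis
  proof (rule orthogonal_sum_growth[OF increment_prod_integrable increment_orthogonal _ assms])
    fix i
    have "(\<integral>\<omega>. increment i \<omega> * increment i \<omega> \<partial>\<Omega>) \<le> (\<integral>\<omega>. 2 * increment_const\<^sup>2 * (V (Y (Suc (Suc i)) \<omega>) + V (Y (Suc i) \<omega>)) \<partial>\<Omega>)"
      using increment_sq_integrable V_moment(1) increment_sq_le by (intro integral_mono) auto
    also have "\<dots> = 2 * increment_const\<^sup>2 * ((\<integral>\<omega>. V (Y (Suc (Suc i)) \<omega>) \<partial>\<Omega>) + (\<integral>\<omega>. V (Y (Suc i) \<omega>) \<partial>\<Omega>))"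
      using V_moment(1) by simp
    also have "\<dots> \<le> 2 * increment_const\<^sup>2 * (c + c)" using c by (intro mult_left_mono add_mono) auto
    finally show "(\<integral>\<omega>. increment i \<omega> * increment i \<omega> \<partial>\<Omega>) \<le> 2 * increment_const\<^sup>2 * (c + c)" .
  qed
qed

lemma U_growth:
  assumes "0 < \<delta>"
  shows "AE \<omega> in \<Omega>. \<exists>c\<ge>0. \<forall>j\<ge>1. U (Y j \<omega>) \<le> c * real j powr ((1 + \<delta>) / p)"
proof -
  obtain c where c: "0 \<le> c" "\<And>n. (\<integral>\<^sup>+\<omega>. ennreal (V (Y n \<omega>)) \<partial>\<Omega>) \<le> ennreal c"
    using moment_bound by blast
  define w where "w n = real (Suc n) powr (- (1 + \<delta>))" for n
  have w0: "0 \<le> w n" for n by (simp add: w_def)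
  have Vm[measurable]: "(\<lambda>\<omega>. V (Y n \<omega>)) \<in> borel_measurable \<Omega>" for n
    using measurable_compose[OF measurable_Y V] .
  have "AE \<omega> in \<Omega>. \<exists>C. \<forall>n. w n * V (Y (Suc n) \<omega>) \<le> C"
  proof (rule AE_bounded_if_summable_expectation)
    show "(\<lambda>\<omega>. w n * V (Y (Suc n) \<omega>)) \<in> borel_measurable \<Omega>" for n by measurable
    show "0 \<le> w n * V (Y (Suc n) \<omega>)" for n \<omega>
      using w0 V_ge_1[of "Y (Suc n) \<omega>"] by simp
    have "summable (\<lambda>n. real n powr (- (1 + \<delta>)))" using assms by (simp add: summable_real_powr_iff)
    then have "summable w" unfolding w_def by (subst (asm) summable_Suc_iff[symmetric])
    then show "summable (\<lambda>n. w n * c)" by (rule summable_mult2)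
    show "0 \<le> w n * c" for n using w0 c by simp
    fix n
    have "(\<integral>\<^sup>+\<omega>. ennreal (w n * V (Y (Suc n) \<omega>)) \<partial>\<Omega>) = ennreal (w n) * (\<integral>\<^sup>+\<omega>. ennreal (V (Y (Suc n) \<omega>)) \<partial>\<Omega>)"
      using w0 by (simp add: ennreal_mult' nn_integral_cmult)
    also have "\<dots> \<le> ennreal (w n) * ennreal c" using c by (intro mult_left_mono) auto
    finally show "(\<integral>\<^sup>+\<omega>. ennreal (w n * V (Y (Suc n) \<omega>)) \<partial>\<Omega>) \<le> ennreal (w n * c)"
      using w0 by (simp add: ennreal_mult')
  qed
  then show ?thesis
  proof eventually_elim
    case (elim \<omega>)
    then obtain C where C: "\<And>n. w n * V (Y (Suc n) \<omega>) \<le> C" by blast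
    \<comment> \<open>Removing the weight gives
      \<open>V (Y j \<omega>) \<le> C * j powr (1 + \<delta>)\<close>, and the \<open>p\<close>-th
      root divides the exponent by \<open>p\<close>.\<close>
    have "U (Y j \<omega>) \<le> C powr (1 / p) * real j powr ((1 + \<delta>) / p)" if j: "1 \<le> j" for j
    proof -
      obtain n where n: "j = Suc n" using j by (cases j) auto
      have "real j powr (1 + \<delta>) * w n = 1" using n by (simp add: w_def flip: powr_add)
      then have "V (Y j \<omega>) = real j powr (1 + \<delta>) * (w n * V (Y (Suc n) \<omega>))" using n by (simp add: mult.assoc[symmetric])
      also have "\<dots> \<le> real j powr (1 + \<delta>) * C" using C by (intro mult_left_mono) auto
      finally have "U (Y j \<omega>) \<le> (real j powr (1 + \<delta>) * C) powr (1 / p)"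
        unfolding U_def using V_ge_1[of "Y j \<omega>"] p by (intro powr_mono2) auto
      then show ?thesis by (simp add: powr_mult powr_powr mult.commute)
    qed
    then show ?case by (intro exI[of _ "C powr (1 / p)"]) auto
  qed
qed

lemma ergodic_sum_growth:
  assumes "0 < \<beta>" "max 0 (1 / (1 + \<beta>) + 1 / p - 1 / 2) < \<epsilon>"
  shows "AE \<omega> in \<Omega>. \<exists>c. \<forall>n\<ge>1. \<bar>\<Sum>j=1..n. g (Y j \<omega>)\<bar> \<le> c * real n powr (1 / 2 + \<epsilon>)"
proof -
  \<comment> \<open>Solves
    \<open>1 / (1 + \<beta>) + (1 + \<delta>) / p = 1 / 2 + \<epsilon>\<close>, so the contribution
    of the parameter changes grows exactly at the target rate; the lower bound on
    \<open>\<epsilon>\<close> says that this \<open>\<delta>\<close> is positive.\<close>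
  define \<delta> where "\<delta> = p * (\<epsilon> + 1 / 2 - 1 / (1 + \<beta>) - 1 / p)"
  define e where "e = (1 + \<delta>) / p"
  have "0 < \<delta>" unfolding \<delta>_def using assms(2) p by (intro mult_pos_pos) auto
  have e: "1 / (1 + \<beta>) + e = 1 / 2 + \<epsilon>" using p by (simp add: e_def \<delta>_def field_simps)
  have e0: "0 \<le> e" using p \<open>0 < \<delta>\<close> by (simp add: e_def)
  \<comment> \<open>The other half of the maximum, \<open>\<epsilon> > 0\<close>, leaves room above
    the exponent \<open>1 / 2\<close> for the orthogonal sums.\<close>
  have "1 / 2 < 1 / 2 + \<epsilon>" using assms(2) by simp
  from increment_sum_growth[OF this] U_growth[OF \<open>0 < \<delta>\<close>] AE_space
  show ?thesis
  proof eventually_elim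
    case (elim \<omega>)
    then obtain C c where C: "\<And>n. n \<ge> 1 \<Longrightarrow> \<bar>\<Sum>i<n. increment i \<omega>\<bar> \<le> C * real n powr (1 / 2 + \<epsilon>)"
      and c: "0 \<le> c" "\<And>j. j \<ge> 1 \<Longrightarrow> U (Y j \<omega>) \<le> c * real j powr e"
      unfolding e_def by blast
    let ?x = "\<lambda>i k. poisson (\<Gamma> i \<omega>) (Y k \<omega>)"
    have "\<bar>\<Sum>j=1..n. g (Y j \<omega>)\<bar> \<le> (C + total_rate * c * (5 + 2 powr e)) * real n powr (1 / 2 + \<epsilon>)" if n: "n \<ge> 1" for n
    proof -
      have "(\<Sum>j=1..n. g (Y j \<omega>)) = (\<Sum>i<n. g (Y (Suc i) \<omega>))"
        by (rule sum.reindex_bij_witness[where i=Suc and j="\<lambda>j. j - 1"]) auto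
      also have "\<dots> = (\<Sum>i<n. increment i \<omega>) + (\<Sum>i<n. ?x (Suc i) (Suc i) - ?x (Suc i) (Suc (Suc i)))"
        unfolding sum.distrib[symmetric] by (intro sum.cong) (auto simp: increment_def)
      finally have "\<bar>\<Sum>j=1..n. g (Y j \<omega>)\<bar>
          \<le> \<bar>\<Sum>i<n. increment i \<omega>\<bar> + \<bar>\<Sum>i<n. ?x (Suc i) (Suc i) - ?x (Suc i) (Suc (Suc i))\<bar>" by simp
      moreover have "\<bar>\<Sum>i<n. ?x (Suc i) (Suc i) - ?x (Suc i) (Suc (Suc i))\<bar>
          \<le> total_rate * c * (5 + 2 powr e) * real n powr (1 / (1 + \<beta>) + e)"
      proof (rule sum_adapted_difference_bound[OF assms(1) elim(3) e0 _ n])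
        show "0 \<le> total_rate * c" using total_rate_nonneg c by simp
        fix j k :: nat assume k: "1 \<le> k"
        have "\<bar>?x j k\<bar> \<le> total_rate * U (Y k \<omega>)" by (rule poisson(1)[OF \<Gamma>_space[OF elim(3)]])
        also have "\<dots> \<le> total_rate * (c * real k powr e)" using c(2)[OF k] total_rate_nonneg by (rule mult_left_mono)
        finally show "\<bar>?x j k\<bar> \<le> total_rate * c * real k powr e" by (simp add: mult.assoc)
      qed
      ultimately show ?thesis using C[OF n] unfolding e by (simp add: distrib_right)
    qed
    then show ?case by blast
  qed
qed

end

section \<open>From the growth of the ergodic sums to the rate of the averages\<close>

theorem corollary4p10:
  fixes \<nu> :: "'x::polish_space measure"
    and I :: "'i measure"
    and \<pi> :: "'i \<Rightarrow> ('x \<times> 'p::polish_space) measure"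
    and P :: "'i \<Rightarrow> 'x \<times> 'p \<Rightarrow> ('x \<times> 'p) measure"
    and \<Omega> :: "'w measure"
    and Y :: "nat \<Rightarrow> 'w \<Rightarrow> 'x \<times> 'p"
    and \<Gamma> :: "nat \<Rightarrow> 'w \<Rightarrow> 'i"
    and d :: "'x \<times> 'p \<Rightarrow> 'x \<times> 'p \<Rightarrow> real"
    and V :: "'x \<times> 'p \<Rightarrow> real"
    and f :: "'x \<Rightarrow> real"
    and \<beta> M \<tau> \<kappa> b p K L \<epsilon> :: real
    and k0 :: nat
  assumes "\<beta> > 0"
    and "air_mcmc_chain \<nu> I \<pi> P \<beta> \<Omega> Y \<Gamma>"
    and "distance_like d"
    and "M \<ge> 1" and "0 \<le> \<tau>" and "\<tau> < 1" and "k0 \<ge> 1"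
    and "\<And>\<gamma>. \<gamma> \<in> space I \<Longrightarrow> contraction_coeff d (P \<gamma>) \<le> ennreal M"
    and "\<And>\<gamma>. \<gamma> \<in> space I \<Longrightarrow> contraction_coeff d (kernel_pow (P \<gamma>) k0) \<le> ennreal \<tau>"
    and "V \<in> borel_measurable borel" and "\<And>y. V y \<ge> 1"
    and "0 < \<kappa>" and "\<kappa> < 1" and "b > 0"
    and "\<And>\<gamma> y. \<gamma> \<in> space I \<Longrightarrow> (\<integral>\<^sup>+y'. ennreal (V y') \<partial>P \<gamma> y) \<le> ennreal (\<kappa> * V y + b)"
    and "p > 2" and "K > 0"
    and "\<And>y1 y2. d y1 y2 \<le> K * (V y1 powr (1 / p) + V y2 powr (1 / p))"
    and "f \<in> borel_measurable borel"
    and "L > 0" and "lipschitz_wrt d L (\<lambda>(x, \<phi>). f x)"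
    and "\<And>x \<phi>. \<bar>f x\<bar> \<le> V (x, \<phi>) powr (1 / p)"
    and "\<epsilon> > max 0 (1 / (1 + \<beta>) + 1 / p - 1 / 2)"
  shows "\<exists>C \<in> borel_measurable \<Omega>. AE \<omega> in \<Omega>. \<forall>n\<ge>1.
    \<bar>(1 / real n) * (\<Sum>j=1..n. f (fst (Y j \<omega>)) - (\<integral>x. f x \<partial>\<nu>))\<bar>
      \<le> 1 / (real n powr (1 / 2 - \<epsilon>)) * C \<omega>"
proof -
  interpret air_mcmc_chain \<nu> I \<pi> P \<beta> \<Omega> Y \<Gamma> by fact
  interpret contracting_air_chain \<nu> I \<pi> P \<beta> \<Omega> Y \<Gamma> d V f M \<tau> \<kappa> b p K L k0
    by unfold_locales (use assms in auto)
  show ?thesis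
  proof (rule measurable_bound_exists)
    have "(\<lambda>\<omega>. f (fst (Y j \<omega>)) - (\<integral>x. f x \<partial>\<nu>)) \<in> borel_measurable \<Omega>" for j
      using measurable_compose[OF measurable_Y g_measurable, of j] by (simp add: g_def)
    then show "(\<lambda>\<omega>. (1 / real n) * (\<Sum>j=1..n. f (fst (Y j \<omega>)) - (\<integral>x. f x \<partial>\<nu>))) \<in> borel_measurable \<Omega>" for n
      by measurable
    show "0 < 1 / (real n powr (1 / 2 - \<epsilon>))" if "n \<ge> 1" for n using that by simp
    show "AE \<omega> in \<Omega>. \<exists>c. \<forall>n\<ge>1. \<bar>(1 / real n) * (\<Sum>j=1..n. f (fst (Y j \<omega>)) - (\<integral>x. f x \<partial>\<nu>))\<bar>
        \<le> 1 / (real n powr (1 / 2 - \<epsilon>)) * c"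
      using ergodic_sum_growth[OF assms(1) assms(23)]
    proof eventually_elim
      case (elim \<omega>)
      then obtain c where c: "\<And>n. n \<ge> 1 \<Longrightarrow> \<bar>\<Sum>j=1..n. g (Y j \<omega>)\<bar> \<le> c * real n powr (1 / 2 + \<epsilon>)" by blast
      show ?case
      proof (intro exI[of _ c] allI impI)
        fix n :: nat assume n: "n \<ge> 1"
        have "\<bar>(1 / real n) * (\<Sum>j=1..n. f (fst (Y j \<omega>)) - (\<integral>x. f x \<partial>\<nu>))\<bar>
            = (1 / real n) * \<bar>\<Sum>j=1..n. g (Y j \<omega>)\<bar>"
          unfolding g_def abs_mult by simp
        also have "\<dots> \<le> (1 / real n) * (c * real n powr (1 / 2 + \<epsilon>))"
          using c[OF n] by (intro mult_left_mono) auto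
        also have "real n powr (1 / 2 + \<epsilon>) = real n * (1 / (real n powr (1 / 2 - \<epsilon>)))"
        proof -
          have "real n powr (1 / 2 + \<epsilon>) * real n powr (1 / 2 - \<epsilon>) = real n"
            using n by (simp flip: powr_add)
          then show ?thesis using n by (simp add: field_simps)
        qed
        also have "(1 / real n) * (c * (real n * (1 / (real n powr (1 / 2 - \<epsilon>))))) = 1 / (real n powr (1 / 2 - \<epsilon>)) * c"
          using n by simp
        finally show "\<bar>(1 / real n) * (\<Sum>j=1..n. f (fst (Y j \<omega>)) - (\<integral>x. f x \<partial>\<nu>))\<bar>
            \<le> 1 / (real n powr (1 / 2 - \<epsilon>)) * c" .
      qed
    qed
  qed
qed

end
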